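(* The sequence of scaled internal cocycle matrices $\bigl(\beta^{n}\,\underline{B}^{(n)}(y)\bigr)_{n\in\mathbb{N}}$ converges compactly on $\mathbb{R}^{d-1}$ (that is, uniformly on every compact subset of $\mathbb{R}^{d-1}$). Consequently, the matrix function $$C(y) := \lim_{n\to\infty}\beta^{n}\,\underline{B}^{(n)}(y),\qquad y\in\mathbb{R}^{d-1},$$ is well defined and continuous.
   Context: Setting. Let $\varrho$ be a primitive substitution on the alphabet $\{a_1,\ldots,a_N\}$ with substitution matrix $M$, where $M_{ij}$ is the number of letters $a_i$ in $\varrho(a_j)$. Let $\lambda$ be the Perron–Frobenius (PF) eigenvalue of $M$, assumed to be a Pisot–Vijayaraghavan (PV) unit of degree $d\leqslant N$: $\lambda>1$ is an algebraic integer and a unit, and all its other algebraic conjugates have modulus $<1$. The characteristic polynomial of $M$ need not be irreducible. Let $v=(v_1,\ldots,v_N)^T$ and $u=(u_1,\ldots,u_N)$ be the strictly positive right and left PF eigenvectors of $M$, normalised by $\sum_i v_i=1$ and $\sum_i u_iv_i=1$. Geometric realisation. Letter $a_i$ is realised as an interval (tile) of length $\ell_i=c\,u_i$ with a constant $c>0$ chosen such that all control points (left endpoints of tiles), relative to one of them placed at $0$, lie in $\mathbb{Z}[\lambda]$, but in no proper $\lambda$-invariant submodule of it. For $1\leqslant i,j\leqslant N$, $T_{ij}\subset\mathbb{Z}[\lambda]$ is the finite set of positions of the left endpoints of the tiles of type $a_i$ in the supertile $\varrho(a_j)$ (of length $\lambda\ell_j$, left endpoint at $0$), so $\operatorname{card}(T_{ij})=M_{ij}$.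 Star map. Let $\kappa_1=\mathrm{id},\kappa_2,\ldots,\kappa_r$ be the real embeddings of $\mathbb{Q}(\lambda)$ and $\sigma_1,\overline{\sigma_1},\ldots,\sigma_s,\overline{\sigma_s}$ the complex ones, $d=r+2s$. For $x\in\mathbb{Z}[\lambda]$, put $x^\star=(\kappa_2(x),\ldots,\kappa_r(x),\operatorname{Re}\sigma_1(x),\operatorname{Im}\sigma_1(x),\ldots,\operatorname{Re}\sigma_s(x),\operatorname{Im}\sigma_s(x))\in\mathbb{R}^{d-1}$. Let $Q$ be the linear map on $\mathbb{R}^{d-1}$ with $(\lambda x)^\star=Qx^\star$, i.e. $Q=\operatorname{diag}(\kappa_2(\lambda),\ldots,\kappa_r(\lambda))\oplus\bigoplus_{i=1}^s\begin{pmatrix}\operatorname{Re}\sigma_i(\lambda)&-\operatorname{Im}\sigma_i(\lambda)\\ \operatorname{Im}\sigma_i(\lambda)&\operatorname{Re}\sigma_i(\lambda)\end{pmatrix}$. Put $R=Q^T$ and $\beta=|\det(R)|=\lambda^{-1}$. Internal cocycle. The internal Fourier matrix is $\underline{B}(y)\in\mathrm{Mat}(N,\mathbb{C})$, $y\in\mathbb{R}^{d-1}$, with $\underline{B}_{ij}(y)=\sum_{x\in T_{ij}}e^{2\pi\mathrm{i}\langle x^\star|y\rangle}$ (standard inner product on $\mathbb{R}^{d-1}$), and $\underline{B}^{(n)}(y)=\underline{B}(y)\,\underline{B}(Ry)\cdots\underline{B}(R^{n-1}y)$ for $n\in\mathbb{N}$. *)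

theory Defs
  imports
    "HOL-Analysis.Analysis"
    "HOL-Computational_Algebra.Computational_Algebra"
    "HOL-Library.Sublist"
begin

section \<open>Primitive substitutions and their Perron--Frobenius data\<close>

text \<open>The alphabet is the finite type \<open>'n\<close>, so \<open>N = CARD('n)\<close>, and a substitution is given by
  the images \<open>\<rho> a\<close> of its letters. These images are non-empty as soon as \<open>\<rho>\<close> is primitive.\<close>

definition subst_word :: "('n \<Rightarrow> 'n list) \<Rightarrow> 'n list \<Rightarrow> 'n list" where
  "subst_word \<rho> xs = concat (map \<rho> xs)"

definition subst_matrix :: "('n::finite \<Rightarrow> 'n list) \<Rightarrow> real ^ 'n ^ 'n" where
  "subst_matrix \<rho> = (\<chi> i j. real (count_list (\<rho> j) i))"

definition primitive_matrix :: "real ^ 'n ^ 'n::finite \<Rightarrow> bool" where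
  "primitive_matrix M \<longleftrightarrow> (\<exists>k\<ge>1. \<forall>i j. (((**) M) ^^ k) (mat 1) $ i $ j > 0)"

definition primitive_subst :: "('n::finite \<Rightarrow> 'n list) \<Rightarrow> bool" where
  "primitive_subst \<rho> \<longleftrightarrow> primitive_matrix (subst_matrix \<rho>)"

definition complex_eigenvalue :: "real ^ 'n ^ 'n::finite \<Rightarrow> complex \<Rightarrow> bool" where
  "complex_eigenvalue M \<mu> \<longleftrightarrow>
     (\<exists>x. x \<noteq> 0 \<and> (\<chi> i j. complex_of_real (M $ i $ j)) *v x = \<mu> *s x)"

definition PF_eigenvalue :: "real ^ 'n ^ 'n::finite \<Rightarrow> real \<Rightarrow> bool" where
  "PF_eigenvalue M lam \<longleftrightarrow>
     complex_eigenvalue M (of_real lam) \<and> (\<forall>\<mu>. complex_eigenvalue M \<mu> \<longrightarrow> cmod \<mu> \<le> lam)"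


section \<open>Pisot--Vijayaraghavan units, the ring \<open>\<int>[lam]\<close> and the field \<open>\<rat>(lam)\<close>\<close>

definition is_min_poly :: "rat poly \<Rightarrow> real \<Rightarrow> bool" where
  "is_min_poly m x \<longleftrightarrow> lead_coeff m = 1 \<and> irreducible m \<and> poly (map_poly of_rat m) x = 0"

definition PV_unit :: "real \<Rightarrow> nat \<Rightarrow> bool" where
  "PV_unit lam d \<longleftrightarrow>
     lam > 1 \<and> algebraic_int lam \<and> algebraic_int (inverse lam) \<and>
     (\<exists>m. is_min_poly m lam \<and> degree m = d \<and>
        (\<forall>z::complex. poly (map_poly of_rat m) z = 0 \<and> z \<noteq> of_real lam \<longrightarrow> cmod z < 1))"

definition int_ring :: "real \<Rightarrow> real set" where
  "int_ring lam = {poly (map_poly of_int p) lam | p :: int poly. True}"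

definition rat_field :: "real \<Rightarrow> real set" where
  "rat_field lam = {poly (map_poly of_rat p) lam / poly (map_poly of_rat q) lam | p q :: rat poly.
                    poly (map_poly of_rat q) lam \<noteq> 0}"

text \<open>Embeddings are represented by extensional functions, so that distinct functions are distinct
  embeddings.\<close>

definition field_embeddings :: "real set \<Rightarrow> (real \<Rightarrow> 'b::field) set" where
  "field_embeddings K = {f \<in> extensional K. f 1 = 1 \<and>
     (\<forall>x\<in>K. \<forall>y\<in>K. f (x + y) = f x + f y \<and> f (x * y) = f x * f y)}"

definition nonreal_embeddings :: "real set \<Rightarrow> (real \<Rightarrow> complex) set" where
  "nonreal_embeddings K = {f \<in> field_embeddings K. \<not> f ` K \<subseteq> \<real>}"

text \<open>\<open>\<kappa> 1 = id, \<kappa> 2, \<dots>, \<kappa> r\<close> lists all real embeddings of \<open>\<rat>(lam)\<close>, and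
  \<open>\<sigma> 1, cnj (\<sigma> 1), \<dots>, \<sigma> s, cnj (\<sigma> s)\<close> all non-real ones, each exactly once.\<close>

definition embedding_system ::
    "real \<Rightarrow> nat \<Rightarrow> nat \<Rightarrow> (nat \<Rightarrow> real \<Rightarrow> real) \<Rightarrow> (nat \<Rightarrow> real \<Rightarrow> complex) \<Rightarrow> bool" where
  "embedding_system lam r s \<kappa> \<sigma> \<longleftrightarrow>
     \<kappa> 1 = restrict id (rat_field lam) \<and>
     bij_betw \<kappa> {1..r} (field_embeddings (rat_field lam)) \<and>
     bij_betw (\<lambda>(j, conj). if conj then restrict (\<lambda>x. cnj (\<sigma> j x)) (rat_field lam) else \<sigma> j)
       ({1..s} \<times> UNIV) (nonreal_embeddings (rat_field lam))"


section \<open>Geometric realisation\<close>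

definition legal_word :: "('n \<Rightarrow> 'n list) \<Rightarrow> 'n list \<Rightarrow> bool" where
  "legal_word \<rho> xs \<longleftrightarrow> (\<exists>k a. sublist xs ((subst_word \<rho> ^^ k) [a]))"

definition subst_hull :: "('n \<Rightarrow> 'n list) \<Rightarrow> (int \<Rightarrow> 'n) set" where
  "subst_hull \<rho> = {w. \<forall>i j. legal_word \<rho> (map w [i..j])}"

text \<open>The left endpoint of the tile \<open>w i\<close> when that of the tile \<open>w 0\<close> is placed at \<open>0\<close>.\<close>

definition control_point :: "('n \<Rightarrow> real) \<Rightarrow> (int \<Rightarrow> 'n) \<Rightarrow> int \<Rightarrow> real" where
  "control_point len w i =
     (if i \<ge> 0 then (\<Sum>k\<in>{0..<i}. len (w k)) else - (\<Sum>k\<in>{i..<0}. len (w k)))"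

definition invariant_submodule :: "real \<Rightarrow> real set \<Rightarrow> bool" where
  "invariant_submodule lam S \<longleftrightarrow> S \<subseteq> int_ring lam \<and> 0 \<in> S \<and>
     (\<forall>x\<in>S. \<forall>y\<in>S. x - y \<in> S) \<and> (\<forall>x\<in>S. lam * x \<in> S)"

definition adapted_lengths :: "real \<Rightarrow> ('n \<Rightarrow> real) \<Rightarrow> (int \<Rightarrow> 'n) \<Rightarrow> bool" where
  "adapted_lengths lam len w \<longleftrightarrow>
     range (control_point len w) \<subseteq> int_ring lam \<and>
     \<not> (\<exists>S. invariant_submodule lam S \<and> S \<noteq> int_ring lam \<and> range (control_point len w) \<subseteq> S)"

definition displacements :: "('n \<Rightarrow> 'n list) \<Rightarrow> ('n \<Rightarrow> real) \<Rightarrow> 'n \<Rightarrow> 'n \<Rightarrow> real set" where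
  "displacements \<rho> len i j =
     {sum_list (map len (take k (\<rho> j))) | k. k < length (\<rho> j) \<and> \<rho> j ! k = i}"


section \<open>Star map\<close>

text \<open>Internal space is \<open>real ^ 'e\<close> with \<open>CARD('e) = d - 1\<close>. A bijection from \<open>'e\<close> onto the
  following set of labels says which entry of
  \<open>(\<kappa> 2 x, \<dots>, \<kappa> r x, Re (\<sigma> 1 x), Im (\<sigma> 1 x), \<dots>, Re (\<sigma> s x), Im (\<sigma> s x))\<close>
  is the \<open>e\<close>-th coordinate of the star image of \<open>x\<close>.\<close>

datatype coord = RealC nat | ReC nat | ImC nat

definition star_coords :: "nat \<Rightarrow> nat \<Rightarrow> coord set" where
  "star_coords r s = RealC ` {2..r} \<union> ReC ` {1..s} \<union> ImC ` {1..s}"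

definition star_map :: "(nat \<Rightarrow> real \<Rightarrow> real) \<Rightarrow> (nat \<Rightarrow> real \<Rightarrow> complex) \<Rightarrow> ('e::finite \<Rightarrow> coord)
    \<Rightarrow> real \<Rightarrow> real ^ 'e" where
  "star_map \<kappa> \<sigma> lab x = (\<chi> e. case lab e of
      RealC i \<Rightarrow> \<kappa> i x
    | ReC j \<Rightarrow> Re (\<sigma> j x)
    | ImC j \<Rightarrow> Im (\<sigma> j x))"

fun star_entry :: "(nat \<Rightarrow> real \<Rightarrow> real) \<Rightarrow> (nat \<Rightarrow> real \<Rightarrow> complex) \<Rightarrow> real
    \<Rightarrow> coord \<Rightarrow> coord \<Rightarrow> real" where
  "star_entry \<kappa> \<sigma> lam (RealC i) (RealC i') = (if i = i' then \<kappa> i lam else 0)"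
| "star_entry \<kappa> \<sigma> lam (ReC j) (ReC j') = (if j = j' then Re (\<sigma> j lam) else 0)"
| "star_entry \<kappa> \<sigma> lam (ReC j) (ImC j') = (if j = j' then - Im (\<sigma> j lam) else 0)"
| "star_entry \<kappa> \<sigma> lam (ImC j) (ReC j') = (if j = j' then Im (\<sigma> j lam) else 0)"
| "star_entry \<kappa> \<sigma> lam (ImC j) (ImC j') = (if j = j' then Re (\<sigma> j lam) else 0)"
| "star_entry \<kappa> \<sigma> lam _ _ = 0"

definition star_matrix :: "(nat \<Rightarrow> real \<Rightarrow> real) \<Rightarrow> (nat \<Rightarrow> real \<Rightarrow> complex) \<Rightarrow> ('e::finite \<Rightarrow> coord)
    \<Rightarrow> real \<Rightarrow> real ^ 'e ^ 'e" where
  "star_matrix \<kappa> \<sigma> lab lam = (\<chi> e f. star_entry \<kappa> \<sigma> lam (lab e) (lab f))"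


section \<open>Internal cocycle\<close>

definition internal_fourier :: "('n::finite \<Rightarrow> 'n \<Rightarrow> real set) \<Rightarrow> (real \<Rightarrow> real ^ 'e::finite)
    \<Rightarrow> real ^ 'e \<Rightarrow> complex ^ 'n ^ 'n" where
  "internal_fourier T star y =
     (\<chi> i j. \<Sum>x\<in>T i j. exp (2 * of_real pi * \<i> * of_real (star x \<bullet> y)))"

fun cocycle :: "(real ^ 'e::finite \<Rightarrow> complex ^ 'n ^ 'n::finite) \<Rightarrow> real ^ 'e ^ 'e
    \<Rightarrow> nat \<Rightarrow> real ^ 'e \<Rightarrow> complex ^ 'n ^ 'n" where
  "cocycle B R 0 y = mat 1"
| "cocycle B R (Suc n) y = cocycle B R n y ** B ((((*v) R) ^^ n) y)"

end

theory Submission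
  imports Defs "HOL-Computational_Algebra.Field_as_Ring"
begin

unbundle no fps_syntax

text \<open>Weighting by the right eigenvector \<open>v\<close>, every factor \<open>\<beta> B (R\<^sup>k y)\<close> has row norm at most \<open>1\<close>,
  because its entries are dominated by those of \<open>\<beta> M\<close> and \<open>\<beta> M v = v\<close>. As \<open>R\<close> is a contraction and
  \<open>B 0 = M\<close>, the factors approach \<open>\<beta> M\<close> exponentially fast, locally uniformly in \<open>y\<close>. Hence a late
  block of the product is close to a power of \<open>\<beta> M\<close>, and these powers converge to \<open>v u\<^sup>T\<close> by
  primitivity; so the partial products form a uniform Cauchy sequence. That \<open>R\<close> contracts and that
  \<open>\<bar>det R\<bar> = 1 / lam\<close> both follow from \<open>Q Q\<^sup>T\<close> being diagonal: the values at \<open>lam\<close> of the listed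
  embeddings are \<open>d\<close> distinct roots of the minimal polynomial, hence all of them, and the product of
  all roots is \<open>\<plusminus>1\<close> because \<open>lam\<close> is a unit.\<close>

section \<open>Convergence of matrix products\<close>

text \<open>New factors are appended on the right, as in \<open>cocycle\<close>; a constant sequence
  gives the powers of a matrix.\<close>

fun mprod :: "(nat \<Rightarrow> 'a::semiring_1 ^ 'n ^ 'n::finite) \<Rightarrow> nat \<Rightarrow> 'a ^ 'n ^ 'n" where
  "mprod A 0 = mat 1"
| "mprod A (Suc n) = mprod A n ** A n"

lemma mprod_add: "mprod A (n + m) = mprod A n ** mprod (\<lambda>k. A (n + k)) m"
  by (induction m) (simp_all add: matrix_mul_assoc)

lemma mprod_const_add: "mprod (\<lambda>_. N) (n + m) = mprod (\<lambda>_. N) n ** mprod (\<lambda>_. N) m"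
  using mprod_add[of "\<lambda>_. N"] by simp

text \<open>Primitivity is formulated with powers built by multiplication on the left, whereas
  \<open>mprod\<close> multiplies on the right; for a constant factor the two agree.\<close>

lemma mprod_const_funpow: "((**) N ^^ k) (mat 1) = mprod (\<lambda>_. N) k"
proof (induction k)
  case (Suc k)
  then show ?case using mprod_const_add[of N 1 k] by simp
qed simp

lemma mprod_scaleR:
  fixes A :: "nat \<Rightarrow> 'a::real_algebra_1 ^ 'n ^ 'n::finite"
  shows "mprod (\<lambda>k. b *\<^sub>R A k) n = b ^ n *\<^sub>R mprod A n"
  by (induction n) (simp_all add: vec_eq_iff matrix_matrix_mult_def scaleR_sum_right mult.commute)

lemma mprod_map_of_real:
  fixes A :: "nat \<Rightarrow> real ^ 'n ^ 'n::finite"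
  shows "mprod (\<lambda>k. \<chi> i j. of_real (A k $ i $ j)) n =
    (\<chi> i j. (of_real (mprod A n $ i $ j) :: 'a::real_field))"
  by (induction n) (simp_all add: vec_eq_iff matrix_matrix_mult_def mat_def)

section \<open>Row norms weighted by a positive vector\<close>

lemma norm_vec_le_sum: "norm (x :: 'b::real_normed_vector ^ 'n::finite) \<le> (\<Sum>i\<in>UNIV. norm (x $ i))"
  unfolding norm_vec_def by (rule L2_set_le_sum) simp

text \<open>For positive \<open>v\<close> this bounds by \<open>a\<close> the operator norm induced
  by the weighted maximum norm max |x_i| / v_i. If a nonnegative matrix has \<open>v\<close> as
  eigenvector, this operator norm is the eigenvalue.\<close>

definition row_bounded :: "real ^ 'n \<Rightarrow> 'a::real_normed_field ^ 'n ^ 'n::finite \<Rightarrow> real \<Rightarrow> bool" where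
  "row_bounded v X a \<longleftrightarrow> (\<forall>i. (\<Sum>j\<in>UNIV. norm (X $ i $ j) * v $ j) \<le> a * v $ i)"

context
  fixes v :: "real ^ 'n::finite"
  assumes v_pos: "\<And>i. v $ i > 0"
begin

lemma row_bounded_mono: "row_bounded v X a \<Longrightarrow> a \<le> b \<Longrightarrow> row_bounded v X b"
  unfolding row_bounded_def using v_pos
  by (meson less_imp_le mult_right_mono order_trans)

lemma row_bounded_mat_1: "row_bounded v (mat 1 :: 'a::real_normed_field ^ 'n ^ 'n) 1"
proof -
  have "norm (mat 1 $ i $ j :: 'a) * v $ j = (if i = j then v $ j else 0)" for i j :: 'n
    by (simp add: mat_def)
  then show ?thesis by (simp add: row_bounded_def)
qed

lemma row_bounded_add:
  assumes "row_bounded v X a" "row_bounded v Y b"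
  shows "row_bounded v (X + Y) (a + b)"
  unfolding row_bounded_def
proof
  fix i
  have "(\<Sum>j\<in>UNIV. norm ((X + Y) $ i $ j) * v $ j) \<le>
      (\<Sum>j\<in>UNIV. norm (X $ i $ j) * v $ j) + (\<Sum>j\<in>UNIV. norm (Y $ i $ j) * v $ j)"
    unfolding sum.distrib[symmetric] distrib_right[symmetric]
    by (intro sum_mono mult_right_mono) (auto simp: norm_triangle_ineq v_pos less_imp_le)
  also have "\<dots> \<le> a * v $ i + b * v $ i"
    using assms unfolding row_bounded_def by (intro add_mono) auto
  finally show "(\<Sum>j\<in>UNIV. norm ((X + Y) $ i $ j) * v $ j) \<le> (a + b) * v $ i"
    by (simp add: distrib_right)
qed

lemma row_bounded_diff:
  assumes "row_bounded v X a" "row_bounded v Y b"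
  shows "row_bounded v (X - Y) (a + b)"
proof -
  have "row_bounded v (- Y) b" using assms(2) by (simp add: row_bounded_def)
  from row_bounded_add[OF assms(1) this] show ?thesis by simp
qed

text \<open>With absolute values taken entrywise, |X Y| v \<le> |X| (|Y| v) \<le> b |X| v \<le> a b
  v.\<close>

lemma row_bounded_mult:
  assumes X: "row_bounded v X a" and Y: "row_bounded v Y b" and b: "b \<ge> 0"
  shows "row_bounded v (X ** Y) (a * b)"
  unfolding row_bounded_def
proof
  fix i
  have "(\<Sum>j\<in>UNIV. norm ((X ** Y) $ i $ j) * v $ j) \<le>
      (\<Sum>j\<in>UNIV. (\<Sum>k\<in>UNIV. norm (X $ i $ k) * norm (Y $ k $ j)) * v $ j)"
    unfolding matrix_matrix_mult_def
    by (intro sum_mono mult_right_mono) (auto intro!: sum_norm_le simp: norm_mult v_pos less_imp_le)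
  also have "\<dots> = (\<Sum>k\<in>UNIV. norm (X $ i $ k) * (\<Sum>j\<in>UNIV. norm (Y $ k $ j) * v $ j))"
    unfolding sum_distrib_right sum_distrib_left by (subst sum.swap) (simp add: mult.assoc)
  also have "\<dots> \<le> (\<Sum>k\<in>UNIV. norm (X $ i $ k) * (b * v $ k))"
    using Y unfolding row_bounded_def by (intro sum_mono mult_left_mono) auto
  also have "\<dots> = b * (\<Sum>k\<in>UNIV. norm (X $ i $ k) * v $ k)"
    by (simp add: sum_distrib_left mult_ac)
  also have "\<dots> \<le> b * (a * v $ i)"
    using X b unfolding row_bounded_def by (intro mult_left_mono) auto
  finally show "(\<Sum>j\<in>UNIV. norm ((X ** Y) $ i $ j) * v $ j) \<le> a * b * v $ i"
    by (simp add: mult_ac)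
qed

lemma row_bounded_mprod:
  assumes "\<And>k. row_bounded v (A k) 1"
  shows "row_bounded v (mprod A n) 1"
proof (induction n)
  case 0
  then show ?case by (simp add: row_bounded_mat_1)
next
  case (Suc n)
  from row_bounded_mult[OF Suc assms] show ?case by simp
qed

text \<open>Telescoping: exchanging the factor with index \<open>k\<close> costs at most
  \<open>c k\<close>, since all other factors have weighted norm at most 1 and do not amplify the
  error.\<close>

lemma row_bounded_mprod_diff:
  assumes A: "\<And>k. row_bounded v (A k) 1" and B: "\<And>k. row_bounded v (B k) 1"
    and AB: "\<And>k. row_bounded v (A k - B k) (c k)" and c: "\<And>k. c k \<ge> 0"
  shows "row_bounded v (mprod A n - mprod B n) (\<Sum>k<n. c k)"
proof (induction n)
  case 0
  then show ?case by (simp add: row_bounded_def)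
next
  case (Suc n)
  have "mprod A (Suc n) - mprod B (Suc n) =
      (mprod A n - mprod B n) ** A n + mprod B n ** (A n - B n)"
    by (simp add: vec_eq_iff matrix_matrix_mult_def left_diff_distrib right_diff_distrib sum_subtractf)
  moreover have "row_bounded v ((mprod A n - mprod B n) ** A n) ((\<Sum>k<n. c k) * 1)"
    by (intro row_bounded_mult Suc A) simp
  moreover have "row_bounded v (mprod B n ** (A n - B n)) (1 * c n)"
    by (intro row_bounded_mult row_bounded_mprod B AB c)
  ultimately show ?case using row_bounded_add by fastforce
qed

text \<open>One constant serves every scale \<open>t\<close> and every matrix \<open>X\<close>, so
  geometrically decreasing entry bounds yield geometrically decreasing row bounds.\<close>

lemma row_bounded_entrywise:
  fixes E :: "'n \<Rightarrow> 'n \<Rightarrow> real"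
  assumes E: "\<And>i j. E i j \<ge> 0"
  shows "\<exists>c\<ge>0. \<forall>t (X :: 'a::real_normed_field ^ 'n ^ 'n).
    t \<ge> 0 \<longrightarrow> (\<forall>i j. norm (X $ i $ j) \<le> E i j * t) \<longrightarrow> row_bounded v X (c * t)"
proof (intro exI conjI allI impI)
  define g where "g i = (\<Sum>j\<in>UNIV. E i j * v $ j) / v $ i" for i
  have g: "g i \<ge> 0" for i
    unfolding g_def by (intro divide_nonneg_pos sum_nonneg mult_nonneg_nonneg) (auto simp: E v_pos less_imp_le)
  show "sum g UNIV \<ge> 0" by (intro sum_nonneg g)
  fix t and X :: "'a ^ 'n ^ 'n"
  assume t: "t \<ge> 0" and X: "\<forall>i j. norm (X $ i $ j) \<le> E i j * t"
  show "row_bounded v X (sum g UNIV * t)"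
    unfolding row_bounded_def
  proof
    fix i
    have "(\<Sum>j\<in>UNIV. norm (X $ i $ j) * v $ j) \<le> (\<Sum>j\<in>UNIV. E i j * t * v $ j)"
      by (intro sum_mono mult_right_mono) (simp_all add: X v_pos less_imp_le)
    also have "\<dots> = (\<Sum>j\<in>UNIV. E i j * v $ j) * t"
      unfolding sum_distrib_right by (simp add: mult_ac)
    also have "\<dots> = g i * t * v $ i"
      using v_pos[of i] by (simp add: g_def)
    also have "\<dots> \<le> sum g UNIV * t * v $ i"
      by (intro mult_right_mono member_le_sum g t) (auto simp: v_pos less_imp_le)
    finally show "(\<Sum>j\<in>UNIV. norm (X $ i $ j) * v $ j) \<le> sum g UNIV * t * v $ i" .
  qed
qed

text \<open>Uniform convergence is measured in the ordinary norm; the comparison factor is the sum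
  of the weights divided by the smallest weight, independently of the matrix.\<close>

lemma row_bounded_norm_bound:
  obtains L where "L > 0" "\<And>X a. row_bounded v (X :: 'a::real_normed_field ^ 'n ^ 'n) a \<Longrightarrow> norm X \<le> L * a"
proof
  define \<mu> where "\<mu> = Min (range (($) v))"
  have \<mu>: "\<mu> > 0" and \<mu>_le: "\<mu> \<le> v $ i" for i
    unfolding \<mu>_def using v_pos by (auto simp: Min_gr_iff)
  show "sum (($) v) UNIV / \<mu> > 0"
    by (intro divide_pos_pos sum_pos \<mu>) (auto simp: v_pos)
  fix X :: "'a ^ 'n ^ 'n" and a
  assume X: "row_bounded v X a"
  have "\<mu> * norm X \<le> \<mu> * (\<Sum>i\<in>UNIV. norm (X $ i))"
    using \<mu> by (intro mult_left_mono norm_vec_le_sum) auto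
  also have "\<dots> \<le> \<mu> * (\<Sum>i\<in>UNIV. \<Sum>j\<in>UNIV. norm (X $ i $ j))"
    using \<mu> by (intro mult_left_mono sum_mono norm_vec_le_sum) auto
  also have "\<dots> \<le> (\<Sum>i\<in>UNIV. \<Sum>j\<in>UNIV. norm (X $ i $ j) * v $ j)"
    unfolding sum_distrib_left
    by (intro sum_mono) (metis \<mu>_le mult.commute mult_left_mono norm_ge_zero)
  also have "\<dots> \<le> (\<Sum>i\<in>UNIV. a * v $ i)"
    using X unfolding row_bounded_def by (intro sum_mono) auto
  finally show "norm X \<le> sum (($) v) UNIV / \<mu> * a"
    using \<mu> by (simp add: field_simps sum_distrib_left)
qed

text \<open>A long product splits into its first \<open>n0\<close> factors and a late block. The
  block is close to a power of \<open>N\<close>, hence to \<open>P\<close>, so all long products are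
  close to the single matrix \<open>mprod (\<lambda>k. A k y) n0 ** P\<close>, uniformly in
  \<open>y\<close>.\<close>

lemma uniformly_convergent_mprod:
  fixes A :: "nat \<Rightarrow> 'y \<Rightarrow> 'a::{real_normed_field,banach} ^ 'n ^ 'n"
  assumes A: "\<And>k y. y \<in> K \<Longrightarrow> row_bounded v (A k y) 1" and N: "row_bounded v N 1"
    and AN: "\<And>k y. y \<in> K \<Longrightarrow> row_bounded v (A k y - N) (c k)"
    and c: "\<And>k. c k \<ge> 0" and sc: "summable c"
    and P: "\<And>e. e > 0 \<Longrightarrow> \<exists>m0. \<forall>m\<ge>m0. row_bounded v (mprod (\<lambda>_. N) m - P) e"
  shows "uniformly_convergent_on K (\<lambda>n y. mprod (\<lambda>k. A k y) n)"
proof (intro Cauchy_uniformly_convergent uniformly_Cauchy_onI)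
  fix e :: real assume e: "e > 0"
  obtain L where L: "L > 0" and norm_le: "\<And>X a. row_bounded v (X :: 'a ^ 'n ^ 'n) a \<Longrightarrow> norm X \<le> L * a"
    using row_bounded_norm_bound by blast
  \<comment> \<open>Two long products are both within 2\<delta> of the same matrix, so their
    difference has norm at most 4 L \<delta> = 4e/5 < e.\<close>
  define \<delta> where "\<delta> = e / (5 * L)"
  have \<delta>: "\<delta> > 0" using e L by (simp add: \<delta>_def)
  obtain n0 where n0: "norm (\<Sum>i. c (i + n)) < \<delta>" if "n \<ge> n0" for n
    using suminf_exist_split[OF \<delta> sc] by blast
  obtain m0 where m0: "row_bounded v (mprod (\<lambda>_. N) m - P) \<delta>" if "m \<ge> m0" for m
    using P[OF \<delta>] by blast
  have near: "row_bounded v (mprod (\<lambda>k. A k y) n - mprod (\<lambda>k. A k y) n0 ** P) (2 * \<delta>)"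
    if y: "y \<in> K" and n: "n \<ge> n0 + m0" for y n
  proof -
    define m where "m = n - n0"
    have n_eq: "n = n0 + m" and m: "m \<ge> m0" using n by (auto simp: m_def)
    let ?X = "mprod (\<lambda>k. A k y) n0" and ?Y = "mprod (\<lambda>k. A (n0 + k) y) m"
    \<comment> \<open>The error of the late block is at most the tail of the series from
      \<open>n0\<close> on, whatever the length \<open>m\<close> of the block.\<close>
    have "(\<Sum>k<m. c (n0 + k)) \<le> (\<Sum>i. c (i + n0))"
      using sum_le_suminf[of "\<lambda>i. c (i + n0)" "{..<m}"] sc c
      by (simp add: summable_iff_shift add.commute)
    also have "\<dots> \<le> \<delta>" using n0[of n0] by simp
    finally have "row_bounded v (?Y - mprod (\<lambda>_. N) m) \<delta>"
      by (intro row_bounded_mono[OF row_bounded_mprod_diff[of _ _ "\<lambda>k. c (n0 + k)"]] A N AN c y)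
    from row_bounded_add[OF this m0[OF m]] have "row_bounded v (?Y - P) (2 * \<delta>)" by simp
    from row_bounded_mult[OF row_bounded_mprod this, of "\<lambda>k. A k y" n0] \<delta> y A
    have "row_bounded v (?X ** (?Y - P)) (2 * \<delta>)" by simp
    moreover have "?X ** (?Y - P) = mprod (\<lambda>k. A k y) n - ?X ** P"
      unfolding n_eq mprod_add
      by (simp add: vec_eq_iff matrix_matrix_mult_def right_diff_distrib sum_subtractf)
    ultimately show ?thesis by simp
  qed
  show "\<exists>M. \<forall>y\<in>K. \<forall>m\<ge>M. \<forall>n\<ge>M. dist (mprod (\<lambda>k. A k y) m) (mprod (\<lambda>k. A k y) n) < e"
  proof (intro exI ballI allI impI)
    fix y m n assume "y \<in> K" "m \<ge> n0 + m0" "n \<ge> n0 + m0"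
    from row_bounded_diff[OF near[OF this(1,2)] near[OF this(1,3)]]
    have "norm (mprod (\<lambda>k. A k y) m - mprod (\<lambda>k. A k y) n) \<le> L * (4 * \<delta>)"
      by (intro norm_le) simp
    also have "\<dots> < e" using e L by (simp add: \<delta>_def field_simps)
    finally show "dist (mprod (\<lambda>k. A k y) m) (mprod (\<lambda>k. A k y) n) < e" by (simp add: dist_norm)
  qed
qed

end

section \<open>Powers of a primitive matrix with eigenvalue one\<close>

lemma mult_rank_one_left:
  fixes X :: "real ^ 'n ^ 'n::finite" and u v :: "real ^ 'n"
  shows "X *v v = v \<Longrightarrow> X ** (\<chi> i j. v $ i * u $ j) = (\<chi> i j. v $ i * u $ j)"
  by (simp add: vec_eq_iff matrix_matrix_mult_def matrix_vector_mult_def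
      flip: mult.assoc sum_distrib_right)

lemma mult_rank_one_right:
  fixes X :: "real ^ 'n ^ 'n::finite" and u v :: "real ^ 'n"
  shows "u v* X = u \<Longrightarrow> (\<chi> i j. v $ i * u $ j) ** X = (\<chi> i j. v $ i * u $ j)"
  by (simp add: vec_eq_iff matrix_matrix_mult_def vector_matrix_mult_def mult.assoc mult.commute[of "X $ _ $ _"]
      flip: sum_distrib_left)

text \<open>Without signs to remove, the weighted row sums are the entries of
  \<open>X *v v\<close>.\<close>

lemma row_bounded_nonneg:
  fixes X :: "real ^ 'n ^ 'n::finite" and v :: "real ^ 'n"
  assumes "\<And>i j. X $ i $ j \<ge> 0" and "X *v v = a *\<^sub>R v"
  shows "row_bounded v X a"
proof -
  have "(\<Sum>j\<in>UNIV. norm (X $ i $ j) * v $ j) = (X *v v) $ i" for i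
    using assms(1) by (simp add: matrix_vector_mult_def)
  then show ?thesis using assms(2) by (simp add: row_bounded_def)
qed

lemma mprod_const_mult_vec:
  fixes N :: "real ^ 'n ^ 'n::finite"
  assumes "N *v v = v"
  shows "mprod (\<lambda>_. N) m *v v = v"
  using assms by (induction m) (simp_all flip: matrix_vector_mul_assoc)

lemma mprod_const_vec_mult:
  fixes N :: "real ^ 'n ^ 'n::finite"
  assumes "u v* N = u"
  shows "u v* mprod (\<lambda>_. N) m = u"
  using assms by (induction m) (simp_all flip: vector_matrix_mul_assoc)

text \<open>If \<open>P = v u\<^sup>T\<close> and \<open>N\<^sup>k \<ge> \<epsilon> P\<close> entrywise, then \<open>E = N\<^sup>k - \<epsilon> P\<close> is nonnegative
  with \<open>E v = (1 - \<epsilon>) v\<close>, and \<open>N\<^sup>k\<^sup>+\<^sup>m - P = E (N\<^sup>m - P)\<close>.\<close>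

lemma primitive_powers_converge:
  fixes N :: "real ^ 'n ^ 'n::finite" and u v :: "real ^ 'n"
  assumes nonneg: "\<And>i j. N $ i $ j \<ge> 0"
    and pos: "\<And>i j. mprod (\<lambda>_. N) k $ i $ j > 0"
    and v: "\<And>i. v $ i > 0" and Nv: "N *v v = v"
    and u: "\<And>i. u $ i > 0" and uN: "u v* N = u"
    and uv: "(\<Sum>i\<in>UNIV. u $ i * v $ i) = 1"
    and e: "e > 0"
  shows "\<exists>m0. \<forall>m\<ge>m0. row_bounded v (mprod (\<lambda>_. N) m - (\<chi> i j. v $ i * u $ j)) e"
proof -
  define P where "P = (\<chi> i j. v $ i * u $ j)"
  define W where "W = mprod (\<lambda>_. N)"
  have Wv: "W m *v v = v" and uW: "u v* W m = u" for m
    by (simp_all add: W_def mprod_const_mult_vec mprod_const_vec_mult Nv uN)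
  have Pv: "P *v v = v"
    using uv by (simp add: P_def matrix_vector_mult_def vec_eq_iff mult.assoc flip: sum_distrib_left)
  have WP: "W m ** P = P" and PW: "P ** W m = P" and PP: "P ** P = P" for m
    using Wv uW Pv by (auto simp: P_def mult_rank_one_left mult_rank_one_right)
  \<comment> \<open>The minimum of the ratios makes \<epsilon> P an entrywise lower bound of
    \<open>W k\<close>; the cap 1/2 secures \<epsilon> < 1.\<close>
  define \<epsilon> where "\<epsilon> = min (1 / 2) (Min (range (\<lambda>(i, j). W k $ i $ j / P $ i $ j)))"
  have P_pos: "P $ i $ j > 0" for i j by (simp add: P_def u v)
  have \<epsilon>: "\<epsilon> > 0" "\<epsilon> < 1"
    unfolding \<epsilon>_def using pos P_pos by (auto simp: W_def)
  have \<epsilon>_le: "\<epsilon> * P $ i $ j \<le> W k $ i $ j" for i j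
  proof -
    have "\<epsilon> \<le> W k $ i $ j / P $ i $ j"
      unfolding \<epsilon>_def by (intro min.coboundedI2 Min_le) (auto intro: rev_image_eqI[of "(i, j)"])
    then show ?thesis using P_pos[of i j] by (simp add: field_simps)
  qed
  define E where "E = W k - \<epsilon> *\<^sub>R P"
  have "row_bounded v E (1 - \<epsilon>)"
  proof (rule row_bounded_nonneg)
    show "E $ i $ j \<ge> 0" for i j using \<epsilon>_le by (simp add: E_def)
    show "E *v v = (1 - \<epsilon>) *\<^sub>R v"
      using Wv Pv by (simp add: E_def matrix_vector_mult_diff_rdistrib scaleR_matrix_vector_assoc[symmetric]
          algebra_simps)
  qed
  have W1: "row_bounded v (W m) 1" for m
    unfolding W_def using v row_bounded_mprod row_bounded_nonneg[OF nonneg] Nv by (metis scaleR_one)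
  \<comment> \<open>The factor 2 is the trivial bound 1 + 1 for the difference of \<open>W m\<close>
    and \<open>P\<close>; each further block of \<open>k\<close> factors contributes 1 -
    \<epsilon>.\<close>
  have W_bound: "row_bounded v (W (k * q + m) - P) ((1 - \<epsilon>) ^ q * 2)" for q m
  proof (induction q)
    case 0
    have "row_bounded v P 1"
      by (rule row_bounded_nonneg) (use P_pos Pv in \<open>auto simp: less_imp_le\<close>)
    with row_bounded_diff[of v, OF v W1 this] show ?case by simp
  next
    case (Suc q)
    \<comment> \<open>\<open>P\<close> absorbs powers of \<open>N\<close> on either side and is
      idempotent, so the two \<epsilon> terms cancel and \<open>W k ** P\<close> collapses to
      \<open>P\<close>.\<close>
    have "E ** (W (k * q + m) - P) = W k ** W (k * q + m) - W k ** P - \<epsilon> *\<^sub>R (P ** W (k * q + m)) + \<epsilon> *\<^sub>R (P ** P)"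
      by (simp add: E_def vec_eq_iff matrix_matrix_mult_def algebra_simps sum_subtractf sum.distrib
          scaleR_sum_right sum_distrib_left)
    also have "\<dots> = W (k * Suc q + m) - P"
      using mprod_const_add[of N k "k * q + m"] by (simp add: WP PW PP add_ac flip: W_def)
    finally show ?case
      using row_bounded_mult[of v, OF v \<open>row_bounded v E (1 - \<epsilon>)\<close> Suc] \<epsilon> by (simp add: mult_ac)
  qed
  have "(\<lambda>q. (1 - \<epsilon>) ^ q * 2) \<longlonglongrightarrow> 0"
    using \<epsilon> by (intro tendsto_mult_left_zero LIMSEQ_power_zero) auto
  then obtain q where q: "(1 - \<epsilon>) ^ q * 2 < e"
    using e by (metis (no_types, lifting) LIMSEQ_le_const linorder_not_le)
  show ?thesis
  proof (intro exI[of _ "k * q"] allI impI)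
    fix m assume "m \<ge> k * q"
    then obtain l where "m = k * q + l" using le_Suc_ex by blast
    with W_bound[of q l] q show "row_bounded v (mprod (\<lambda>_. N) m - (\<chi> i j. v $ i * u $ j)) e"
      using row_bounded_mono[of v, OF v] by (metis P_def W_def less_imp_le)
  qed
qed

section \<open>Conjugates of an algebraic unit\<close>

lemma complex_of_real_of_rat: "complex_of_real (of_rat x) = of_rat x"
proof -
  obtain a b where "quotient_of x = (a, b)" by (cases "quotient_of x")
  from quotient_of_div[OF this] show ?thesis by (simp add: of_rat_divide)
qed

lemma rat_poly_clear_denominators:
  fixes p :: "rat poly"
  obtains b :: int and q :: "int poly" where "b > 0" "smult (of_int b) p = map_poly of_int q"
proof -
  have "\<exists>b q. b > (0::int) \<and> smult (of_int b) p = map_poly of_int q"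
  proof (induction p)
    case 0
    show ?case by (intro exI[of _ 1] exI[of _ 0]) simp
  next
    case (pCons a p)
    then obtain b q where b: "b > (0::int)" and q: "smult (of_int b) p = map_poly of_int q" by blast
    obtain x y where xy: "quotient_of a = (x, y)" by (cases "quotient_of a")
    have y: "y > 0" and a: "a = of_int x / of_int y"
      using quotient_of_denom_pos[OF xy] quotient_of_div[OF xy] by auto
    have "smult (of_int (y * b)) (pCons a p) = map_poly of_int (pCons (x * b) (smult y q))"
    proof (rule poly_eqI)
      fix n
      have "coeff (smult (of_int b) p) m = coeff (map_poly of_int q) m" for m using q by simp
      then have "of_int b * coeff p m = of_int (coeff q m)" for m by (simp add: coeff_map_poly)
      then show "coeff (smult (of_int (y * b)) (pCons a p)) n =
          coeff (map_poly of_int (pCons (x * b) (smult y q))) n"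
        using y by (auto simp: coeff_pCons coeff_map_poly a mult.assoc split: nat.splits)
    qed
    with b y show ?case by (metis mult_pos_pos)
  qed
  then show ?thesis using that by blast
qed

lemma map_poly_of_int_mult:
  "map_poly of_int (p * q) = (map_poly of_int p * map_poly of_int q :: 'a::comm_ring_1 poly)"
  by (intro poly_eqI) (simp add: coeff_map_poly coeff_mult)

lemma map_poly_of_int_inject:
  "map_poly of_int p = (map_poly of_int q :: 'a::ring_char_0 poly) \<longleftrightarrow> p = q"
  by (auto simp: poly_eq_iff coeff_map_poly)

text \<open>Gauss's lemma: the content is multiplicative, so the primitive part of \<open>m\<close>
  with denominators cleared divides \<open>p\<close> over the integers. As \<open>m\<close> is
  monic, this primitive part is its own leading coefficient times \<open>m\<close>.\<close>

lemma gauss_factorisation: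
  fixes m g :: "rat poly" and p :: "int poly"
  assumes mg: "m * g = map_poly of_int p" and p0: "p \<noteq> 0" and lm: "lead_coeff m = 1"
  obtains m1 g1 :: "int poly" where "p = m1 * g1" "smult (of_int (lead_coeff m1)) m = map_poly of_int m1"
proof -
  obtain a m' where a: "a > 0" "smult (of_int a) m = map_poly of_int m'"
    by (rule rat_poly_clear_denominators)
  obtain b g' where b: "b > 0" "smult (of_int b) g = map_poly of_int g'"
    by (rule rat_poly_clear_denominators)
  have "map_poly of_int (m' * g') = smult (of_int a) m * smult (of_int b) g"
    by (simp add: map_poly_of_int_mult a b)
  also have "\<dots> = smult (of_int (a * b)) (map_poly of_int p)"
    using mg by (simp add: mult_ac)
  also have "\<dots> = map_poly of_int (smult (a * b) p)"
    by (intro poly_eqI) (simp add: coeff_map_poly)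
  finally have eq: "m' * g' = smult (a * b) p" by (simp only: map_poly_of_int_inject)
  \<comment> \<open>Comparing contents on both sides of \<open>eq\<close> yields the relation that
    later cancels the scalar \<open>a * b\<close>.\<close>
  define x y where "x = content m'" and "y = content g'"
  have c: "x * y = a * b * content p"
    using arg_cong[OF eq, of content] a(1) b(1)
    by (simp add: content_mult x_def y_def abs_mult)
  define m1 where "m1 = primitive_part m'"
  define g1 where "g1 = smult (content p) (primitive_part g')"
  have m'_eq: "m' = smult x m1" and g'_eq: "g' = smult y (primitive_part g')"
    by (simp_all add: x_def y_def m1_def)
  have "smult (a * b) p = smult (x * y) (m1 * primitive_part g')"
    using eq by (metis m'_eq g'_eq mult_smult_left mult_smult_right smult_smult)
  also have "\<dots> = smult (a * b) (m1 * g1)" by (simp add: c g1_def)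
  finally have "p = m1 * g1" using a(1) b(1) by (auto simp: poly_eq_iff)
  have "x \<noteq> 0"
    using c p0 a(1) b(1) by auto
  have sm: "smult (of_int a) m = smult (of_int x) (map_poly of_int m1)"
    unfolding a(2) by (subst m'_eq) (intro poly_eqI, simp add: coeff_map_poly)
  then have "lead_coeff (smult (of_int a) m) = lead_coeff (smult (of_int x) (map_poly of_int m1))"
    by simp
  then have ax: "of_int a = of_int x * (of_int (lead_coeff m1) :: rat)"
    using lm a(1) \<open>x \<noteq> 0\<close> by (simp add: degree_map_poly coeff_map_poly)
  have "smult (of_int x) (smult (of_int (lead_coeff m1)) m) = smult (of_int x) (map_poly of_int m1)"
    using sm unfolding ax by simp
  then have "smult (of_int (lead_coeff m1)) m = map_poly of_int m1"
    using \<open>x \<noteq> 0\<close> by (auto simp: poly_eq_iff)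
  with \<open>p = m1 * g1\<close> that show ?thesis by blast
qed

lemma map_poly_of_rat_mult:
  "map_poly of_rat (p * q) = (map_poly of_rat p * map_poly of_rat q :: 'a::field_char_0 poly)"
  by (intro poly_eqI) (simp add: coeff_map_poly coeff_mult of_rat_sum of_rat_mult)

lemma map_poly_of_rat_add:
  "map_poly of_rat (p + q) = (map_poly of_rat p + map_poly of_rat q :: 'a::field_char_0 poly)"
  by (intro poly_eqI) (simp add: coeff_map_poly of_rat_add)

text \<open>Otherwise the two polynomials are coprime, and a Bezout identity evaluated at the common
  root reads 0 = 1.\<close>

lemma irreducible_root_dvd:
  fixes m g :: "rat poly" and x :: "'a::field_char_0"
  assumes "irreducible m" and m: "poly (map_poly of_rat m) x = 0" and g: "poly (map_poly of_rat g) x = 0"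
  shows "m dvd g"
proof (rule ccontr)
  assume "\<not> m dvd g"
  then have "coprime m g"
    using \<open>irreducible m\<close> using prime_elem_imp_coprime irreducible_imp_prime_elem_gcd by blast
  then obtain a b where "a * m + b * g = 1"
    using bezout_coefficients_fst_snd[of m g] by (metis coprime_iff_gcd_eq_1)
  then have "poly (map_poly of_rat (a * m + b * g)) x = (1 :: 'a)" by simp
  then show False by (simp add: map_poly_of_rat_mult map_poly_of_rat_add m g)
qed

lemma map_poly_of_rat_of_int:
  "map_poly of_rat (map_poly of_int p) = (map_poly of_int p :: 'a::field_char_0 poly)"
  by (intro poly_eqI) (simp add: coeff_map_poly)

text \<open>Gauss's lemma for a monic integer polynomial of \<open>lam\<close> shows that the
  constant term of \<open>m\<close> is an integer. Applied to the reflection of a monic integer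
  polynomial of \<open>inverse lam\<close>, it shows that this integer divides 1.\<close>

lemma min_poly_unit_coeff_0:
  fixes lam :: real
  assumes m: "is_min_poly m lam" and "algebraic_int lam" "algebraic_int (inverse lam)" and "lam \<noteq> 0"
  shows "\<bar>coeff m 0\<bar> = 1"
proof -
  have irr: "irreducible m" and lm: "lead_coeff m = 1" and rt: "poly (map_poly of_rat m) lam = 0"
    using m by (auto simp: is_min_poly_def)
  obtain p where p: "poly (map_poly of_int p) lam = 0" "lead_coeff p = 1"
    using assms(2) by (auto simp: algebraic_int_altdef_ipoly)
  obtain q where q: "poly (map_poly of_int q) (inverse lam) = 0" "lead_coeff q = 1"
    using assms(3) by (auto simp: algebraic_int_altdef_ipoly)
  have factor: "\<exists>m1 g1. h = m1 * g1 \<and> smult (of_int (lead_coeff m1)) m = map_poly of_int m1"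
    if h: "poly (map_poly of_int h) lam = 0" "h \<noteq> 0" for h
  proof -
    have "m dvd map_poly of_int h"
      by (rule irreducible_root_dvd[OF irr rt]) (simp add: map_poly_of_rat_of_int h)
    then obtain g where "m * g = map_poly of_int h" by (metis dvdE)
    with h(2) lm show ?thesis using gauss_factorisation by metis
  qed
  have "coeff m 0 \<in> \<int>"
  proof -
    from p obtain m1 g1 where mg: "p = m1 * g1" "smult (of_int (lead_coeff m1)) m = map_poly of_int m1"
      using factor[of p] by fastforce
    have "lead_coeff m1 * lead_coeff g1 = 1" using p(2) mg(1) by (simp add: lead_coeff_mult)
    then have "lead_coeff m1 = 1 \<or> lead_coeff m1 = -1" using zmult_eq_1_iff by blast
    moreover have "of_int (lead_coeff m1) * coeff m 0 = of_int (coeff m1 0)"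
      using arg_cong[OF mg(2), of "\<lambda>p. coeff p 0"] by (simp add: coeff_map_poly)
    ultimately show ?thesis
      by (metis Ints_minus Ints_of_int minus_minus mult.left_neutral mult_minus1 of_int_1 of_int_minus)
  qed
  then obtain z where z: "coeff m 0 = of_int z" by (auto elim: Ints_cases)
  \<comment> \<open>Reversing the coefficients inverts the root and moves the leading coefficient 1
    to the constant term.\<close>
  have "poly (map_poly of_int (reflect_poly q)) lam = 0"
  proof -
    have "(map_poly of_int (reflect_poly q) :: real poly) = reflect_poly (map_poly of_int q)"
      by (intro poly_eqI) (simp add: coeff_map_poly coeff_reflect_poly degree_map_poly)
    then show ?thesis
      using q(1) \<open>lam \<noteq> 0\<close> using poly_reflect_poly_nz[of lam "map_poly of_int q"] by simp
  qed
  moreover have "reflect_poly q \<noteq> 0" using q(2) by auto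
  ultimately obtain m1 g1 where
      mg: "reflect_poly q = m1 * g1" "smult (of_int (lead_coeff m1)) m = map_poly of_int m1"
    using factor by blast
  \<comment> \<open>The constant term of \<open>m1\<close> is a unit of the integers, and
    \<open>z\<close> divides it.\<close>
  have "coeff m1 0 * coeff g1 0 = 1"
    using arg_cong[OF mg(1), of "\<lambda>p. coeff p 0"] q(2) by (simp add: coeff_mult_0)
  moreover have "of_int (lead_coeff m1) * coeff m 0 = of_int (coeff m1 0)"
    using arg_cong[OF mg(2), of "\<lambda>p. coeff p 0"] by (simp add: coeff_map_poly)
  then have "lead_coeff m1 * z = coeff m1 0"
    unfolding z by (simp flip: of_int_mult)
  ultimately have "z dvd 1" by (metis dvd_def dvd_mult_left mult.commute)
  then show ?thesis by (auto simp: z zdvd1_eq)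
qed

section \<open>The field generated by \<open>lam\<close> and its embeddings\<close>

lemma poly_in_rat_field: "poly (map_poly of_rat p) lam \<in> rat_field lam"
  unfolding rat_field_def by (intro CollectI exI[of _ p] exI[of _ 1]) simp

lemma inverse_poly_in_rat_field:
  assumes "poly (map_poly of_rat q) lam \<noteq> 0"
  shows "inverse (poly (map_poly of_rat q) lam) \<in> rat_field lam"
  unfolding rat_field_def using assms
  by (intro CollectI exI[of _ 1] exI[of _ q]) (simp add: inverse_eq_divide)

lemma of_rat_in_rat_field: "of_rat x \<in> rat_field lam"
  using poly_in_rat_field[of "[:x:]" lam] by (simp add: map_poly_pCons)

lemma gen_in_rat_field: "lam \<in> rat_field lam"
  using poly_in_rat_field[of "[:0, 1:]" lam] by (simp add: map_poly_pCons)

context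
  fixes lam :: real and f :: "real \<Rightarrow> 'b::field_char_0"
  assumes f: "f \<in> field_embeddings (rat_field lam)"
begin

lemma embedding_1: "f 1 = 1"
  and embedding_add: "x \<in> rat_field lam \<Longrightarrow> y \<in> rat_field lam \<Longrightarrow> f (x + y) = f x + f y"
  and embedding_mult: "x \<in> rat_field lam \<Longrightarrow> y \<in> rat_field lam \<Longrightarrow> f (x * y) = f x * f y"
  using f by (auto simp: field_embeddings_def)

lemma embedding_of_int: "f (of_int n) = of_int n"
proof -
  have K: "of_int n \<in> rat_field lam" for n using of_rat_in_rat_field[of "of_int n"] by simp
  have f0: "f 0 = 0" using embedding_add[of 0 0] K[of 0] by simp
  have nat: "f (of_nat k) = of_nat k" for k
  proof (induction k)
    case (Suc k)
    then show ?case using embedding_add[of 1 "of_nat k"] K[of 1] K[of "int k"] embedding_1 by simp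
  qed (simp add: f0)
  have "f (of_int n) + f (of_int (- n)) = 0"
    using embedding_add[of "of_int n" "of_int (- n)"] K[of n] K[of "- n"] f0 by simp
  with nat[of "nat n"] nat[of "nat (- n)"] show ?thesis
    by (cases "n \<ge> 0") (auto simp: add_eq_0_iff)
qed

lemma embedding_of_rat: "f (of_rat x) = of_rat x"
proof -
  obtain a b where ab: "quotient_of x = (a, b)" by (cases "quotient_of x")
  have b: "b \<noteq> 0" and x: "x = of_int a / of_int b"
    using quotient_of_denom_pos[OF ab] quotient_of_div[OF ab] by auto
  have "f (of_rat x * of_int b) = f (of_rat x) * of_int b"
    using embedding_mult[OF of_rat_in_rat_field[of x] of_rat_in_rat_field[of "of_int b"]]
    by (simp add: embedding_of_int)
  moreover have "of_rat x * of_int b = (of_int a :: real)" using b by (simp add: x of_rat_divide)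
  ultimately have "of_int a = f (of_rat x) * of_int b" by (simp add: embedding_of_int)
  then show ?thesis using b by (simp add: x of_rat_divide field_simps)
qed

lemma embedding_poly: "f (poly (map_poly of_rat p) lam) = poly (map_poly of_rat p) (f lam)"
proof (induction p)
  case 0
  then show ?case using embedding_of_int[of 0] by simp
next
  case (pCons a p)
  have "lam * poly (map_poly of_rat p) lam = poly (map_poly of_rat (pCons 0 p)) lam"
    by (simp add: map_poly_pCons)
  then have "lam * poly (map_poly of_rat p) lam \<in> rat_field lam"
    by (metis poly_in_rat_field)
  then show ?case
    using pCons by (simp add: map_poly_pCons embedding_add embedding_mult of_rat_in_rat_field
        gen_in_rat_field poly_in_rat_field embedding_of_rat)
qed

text \<open>The image of the denominator is nonzero because its product with the image of the
  inverse is \<open>f 1 = 1\<close>.\<close>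

lemma embedding_quotient:
  assumes q: "poly (map_poly of_rat q) lam \<noteq> 0"
  shows "f (poly (map_poly of_rat p) lam / poly (map_poly of_rat q) lam) =
    poly (map_poly of_rat p) (f lam) / poly (map_poly of_rat q) (f lam)"
proof -
  let ?q = "poly (map_poly of_rat q) lam"
  have "f ?q * f (inverse ?q) = 1"
    using embedding_mult[OF poly_in_rat_field inverse_poly_in_rat_field[OF q], of q] q embedding_1
    by simp
  then have "f (inverse ?q) = 1 / f ?q"
    by (metis mult_zero_left nonzero_eq_divide_eq mult.commute zero_neq_one)
  then show ?thesis
    using embedding_mult[OF poly_in_rat_field inverse_poly_in_rat_field[OF q], of p]
    by (simp add: divide_inverse embedding_poly)
qed

end

text \<open>Field elements are quotients of polynomial values at \<open>lam\<close>, so the image of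
  \<open>lam\<close> determines all others; extensionality settles the arguments outside the
  field.\<close>

lemma embedding_eqI:
  fixes f g :: "real \<Rightarrow> 'b::field_char_0"
  assumes f: "f \<in> field_embeddings (rat_field lam)" and g: "g \<in> field_embeddings (rat_field lam)"
    and eq: "f lam = g lam"
  shows "f = g"
proof (rule extensionalityI)
  show "f \<in> extensional (rat_field lam)" "g \<in> extensional (rat_field lam)"
    using f g by (auto simp: field_embeddings_def)
  fix x assume "x \<in> rat_field lam"
  then show "f x = g x"
    using eq by (auto simp: rat_field_def embedding_quotient[OF f] embedding_quotient[OF g])
qed

lemma poly_rat_complex_of_real:
  "poly (map_poly of_rat p) (complex_of_real x) = of_real (poly (map_poly of_rat p) x)"
  by (induction p) (simp_all add: map_poly_pCons complex_of_real_of_rat)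

text \<open>A real image of \<open>lam\<close> would make the image of every quotient of polynomial
  values at \<open>lam\<close> real.\<close>

lemma nonreal_embedding_at_gen:
  assumes "f \<in> nonreal_embeddings (rat_field lam)"
  shows "f lam \<notin> \<real>"
proof
  assume "f lam \<in> \<real>"
  then obtain t where t: "f lam = of_real t" by (auto elim: Reals_cases)
  have f: "f \<in> field_embeddings (rat_field lam)" using assms by (simp add: nonreal_embeddings_def)
  have "f ` rat_field lam \<subseteq> \<real>"
    by (auto simp: rat_field_def embedding_quotient[OF f] t poly_rat_complex_of_real)
  with assms show False by (simp add: nonreal_embeddings_def)
qed

section \<open>The complete system of conjugates of \<open>lam\<close>\<close>

context
  fixes lam :: real and r s :: nat and \<kappa> :: "nat \<Rightarrow> real \<Rightarrow> real" and \<sigma> :: "nat \<Rightarrow> real \<Rightarrow> complex"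
  assumes sys: "embedding_system lam r s \<kappa> \<sigma>"
begin

lemma real_embedding: "i \<in> {1..r} \<Longrightarrow> \<kappa> i \<in> field_embeddings (rat_field lam)"
  using sys unfolding embedding_system_def by (meson bij_betw_apply)

lemma nonreal_embedding:
  assumes "j \<in> {1..s}"
  shows "\<sigma> j \<in> nonreal_embeddings (rat_field lam)"
proof -
  let ?g = "\<lambda>(j, conj). if conj then restrict (\<lambda>x. cnj (\<sigma> j x)) (rat_field lam) else \<sigma> j"
  have "bij_betw ?g ({1..s} \<times> UNIV) (nonreal_embeddings (rat_field lam))"
    using sys unfolding embedding_system_def by blast
  from bij_betw_apply[OF this, of "(j, False)"] assms show ?thesis by simp
qed

text \<open>\<open>embedding_system\<close> prescribes \<open>\<kappa> 1\<close> but does not state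
  \<open>r \<ge> 1\<close>. That follows because the identity is itself a real embedding, so the
  list of real embeddings is not empty.\<close>

lemma one_in_real_index: "1 \<in> {1..r}" and kappa_1: "\<kappa> 1 lam = lam"
proof -
  have "restrict id (rat_field lam) \<in> field_embeddings (rat_field lam)"
  proof -
    have "x + y \<in> rat_field lam \<and> x * y \<in> rat_field lam"
      if xy: "x \<in> rat_field lam" "y \<in> rat_field lam" for x y
    proof -
      obtain p q where q: "poly (map_poly of_rat q) lam \<noteq> 0"
        and x: "x = poly (map_poly of_rat p) lam / poly (map_poly of_rat q) lam"
        using xy(1) by (auto simp: rat_field_def)
      obtain p' q' where q': "poly (map_poly of_rat q') lam \<noteq> 0"
        and y: "y = poly (map_poly of_rat p') lam / poly (map_poly of_rat q') lam"
        using xy(2) by (auto simp: rat_field_def)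
      have "x + y = poly (map_poly of_rat (p * q' + p' * q)) lam / poly (map_poly of_rat (q * q')) lam"
        unfolding x y add_frac_eq[OF q q'] map_poly_of_rat_mult map_poly_of_rat_add poly_add poly_mult ..
      moreover have "x * y = poly (map_poly of_rat (p * p')) lam / poly (map_poly of_rat (q * q')) lam"
        by (simp add: x y map_poly_of_rat_mult)
      moreover have "poly (map_poly of_rat (q * q')) lam \<noteq> 0"
        using q q' by (simp add: map_poly_of_rat_mult)
      ultimately show ?thesis unfolding rat_field_def by blast
    qed
    then show ?thesis
      using of_rat_in_rat_field[of 1 lam] by (auto simp: field_embeddings_def)
  qed
  then have "{1..r} \<noteq> {}" using sys unfolding embedding_system_def by (metis bij_betw_imp_surj_on image_is_empty empty_iff)
  then show "1 \<in> {1..r}" by auto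
  show "\<kappa> 1 lam = lam"
    using sys gen_in_rat_field by (simp add: embedding_system_def)
qed

text \<open>The value \<open>lam\<close> at \<open>lam\<close> belongs to \<open>\<kappa> 1\<close>
  alone, since the list has no repetitions. Thus the PV condition applies to all real conjugates of
  higher index.\<close>

lemma kappa_ne_gen: "i \<in> {2..r} \<Longrightarrow> \<kappa> i lam \<noteq> lam"
proof
  assume i: "i \<in> {2..r}" and "\<kappa> i lam = lam"
  then have "\<kappa> i = \<kappa> 1"
    using embedding_eqI[OF real_embedding real_embedding, of i 1] kappa_1 by auto
  moreover have "inj_on \<kappa> {1..r}" using sys by (auto simp: embedding_system_def bij_betw_def)
  ultimately have "i = 1" using i by (auto dest: inj_onD)
  with i show False by simp
qed

context
  fixes m :: "rat poly"
  assumes m: "is_min_poly m lam"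
begin

text \<open>An embedding fixes rational numbers, hence commutes with rational polynomials and maps
  roots of \<open>m\<close> to roots of \<open>m\<close>.\<close>

lemma root_real: "i \<in> {1..r} \<Longrightarrow> poly (map_poly of_rat m) (\<kappa> i lam) = 0"
  using embedding_poly[OF real_embedding, of i m] embedding_of_int[OF real_embedding, of i 0] m
  by (simp add: is_min_poly_def)

lemma root_complex_of_real:
  "i \<in> {1..r} \<Longrightarrow> poly (map_poly of_rat m) (complex_of_real (\<kappa> i lam)) = 0"
  by (simp add: poly_rat_complex_of_real root_real)

lemma root_nonreal: "j \<in> {1..s} \<Longrightarrow> poly (map_poly of_rat m) (\<sigma> j lam) = 0"
proof -
  assume "j \<in> {1..s}"
  then have f: "\<sigma> j \<in> field_embeddings (rat_field lam)"
    using nonreal_embedding by (auto simp: nonreal_embeddings_def)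
  show ?thesis
    using embedding_poly[OF f, of m] embedding_of_int[OF f, of 0] m by (simp add: is_min_poly_def)
qed

lemma root_nonreal_cnj: "j \<in> {1..s} \<Longrightarrow> poly (map_poly of_rat m) (cnj (\<sigma> j lam)) = 0"
proof -
  have "poly (map_poly of_rat p) (cnj x) = cnj (poly (map_poly of_rat p) x)" for p x
  proof (induction p)
    case (pCons a p)
    have "cnj (of_rat a) = of_rat a" by (metis complex_cnj_complex_of_real complex_of_real_of_rat)
    with pCons show ?case by (simp add: map_poly_pCons)
  qed simp
  then show "j \<in> {1..s} \<Longrightarrow> ?thesis" using root_nonreal by simp
qed

text \<open>The listed conjugates are pairwise distinct roots of \<open>m\<close>, as many as its
  degree, hence all roots with multiplicity one. Up to sign their product is the constant term, and
  each conjugate pair contributes a squared modulus.\<close>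

lemma prod_conjugates:
  assumes deg: "degree m = r + 2 * s"
  shows "(\<Prod>i\<in>{1..r}. \<bar>\<kappa> i lam\<bar>) * (\<Prod>j\<in>{1..s}. (cmod (\<sigma> j lam))\<^sup>2) = \<bar>of_rat (coeff m 0)\<bar>"
proof -
  define f where "f i = complex_of_real (\<kappa> i lam)" for i
  define g where "g = (\<lambda>(j, c). if c then cnj (\<sigma> j lam) else \<sigma> j lam)"
  let ?J = "{1..s} \<times> (UNIV :: bool set)"
  have inj_f: "inj_on f {1..r}"
  proof (rule inj_onI)
    fix i i' assume i: "i \<in> {1..r}" "i' \<in> {1..r}" and "f i = f i'"
    then have "\<kappa> i = \<kappa> i'"
      by (intro embedding_eqI[of _ lam] real_embedding) (simp_all add: f_def)
    with i sys show "i = i'" by (auto simp: embedding_system_def bij_betw_def dest: inj_onD)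
  qed
  have inj_g: "inj_on g ?J"
  proof (rule inj_onI)
    let ?h = "\<lambda>(j, conj). if conj then restrict (\<lambda>x. cnj (\<sigma> j x)) (rat_field lam) else \<sigma> j"
    have bij: "bij_betw ?h ?J (nonreal_embeddings (rat_field lam))"
      using sys unfolding embedding_system_def by blast
    fix a b assume ab: "a \<in> ?J" "b \<in> ?J" and eq: "g a = g b"
    have emb: "?h c \<in> field_embeddings (rat_field lam)" if "c \<in> ?J" for c
      using bij_betw_apply[OF bij that] by (simp only: nonreal_embeddings_def mem_Collect_eq)
    have h_gen: "?h c lam = g c" for c
      by (cases c) (simp add: g_def gen_in_rat_field)
    have "?h a = ?h b"
      by (rule embedding_eqI[OF emb[OF ab(1)] emb[OF ab(2)]]) (simp only: h_gen eq)
    then show "a = b"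
      by (rule inj_onD[OF bij_betw_imp_inj_on[OF bij] _ ab])
  qed
  \<comment> \<open>A coincidence would make \<open>\<sigma> j lam\<close> real.\<close>
  have "f i \<noteq> g (j, c)" if "j \<in> {1..s}" for i j c
  proof
    assume "f i = g (j, c)"
    then have "\<sigma> j lam = complex_of_real (\<kappa> i lam)"
      by (cases c) (simp_all add: f_def g_def, metis complex_cnj_cnj complex_cnj_complex_of_real)
    then show False using nonreal_embedding_at_gen[OF nonreal_embedding[OF that]] by simp
  qed
  then have disj: "f ` {1..r} \<inter> g ` ?J = {}" by fast
  define S where "S = f ` {1..r} \<union> g ` ?J"
  have card_S: "card S = r + 2 * s"
    unfolding S_def using inj_f inj_g disj
    by (subst card_Un_disjoint) (auto simp: card_image card_cartesian_product)
  have fin: "finite S" by (simp add: S_def)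
  have roots: "poly (map_poly of_rat m) z = 0" if "z \<in> S" for z
    using that root_complex_of_real root_nonreal root_nonreal_cnj
    by (auto simp: S_def f_def g_def)
  \<comment> \<open>Both sides are monic of degree r + 2 s and vanish at the r + 2 s points of
    \<open>S\<close>.\<close>
  have "map_poly of_rat m = (\<Prod>z\<in>S. [:- z, 1:])"
  proof (rule poly_eqI_degree_lead_coeff[where n = "r + 2 * s" and A = S])
    have dP: "degree (\<Prod>z\<in>S. [:- z, 1:]) = r + 2 * s"
      using fin card_S by (subst degree_prod_eq_sum_degree) auto
    have "lead_coeff (\<Prod>z\<in>S. [:- z, 1:]) = 1" by (simp add: lead_coeff_prod)
    moreover have "coeff (map_poly of_rat m) (degree m) = (1 :: complex)"
      using m by (simp add: coeff_map_poly is_min_poly_def)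
    ultimately show "coeff (map_poly of_rat m) (r + 2 * s) = coeff (\<Prod>z\<in>S. [:- z, 1:]) (r + 2 * s)"
      using dP deg by simp
    show "degree (map_poly of_rat m :: complex poly) \<le> r + 2 * s"
      using deg by (simp add: degree_map_poly)
    show "degree (\<Prod>z\<in>S. [:- z, 1:]) \<le> r + 2 * s" using dP by simp
    show "poly (map_poly of_rat m) z = poly (\<Prod>z\<in>S. [:- z, 1:]) z" if "z \<in> S" for z
      using that fin roots by (auto simp: poly_prod)
  qed (simp add: card_S)
  then have "coeff (map_poly of_rat m) 0 = poly (\<Prod>z\<in>S. [:- z, 1:]) 0"
    by (metis poly_0_coeff_0)
  then have "of_rat (coeff m 0) = (\<Prod>z\<in>S. - z)" by (simp add: coeff_map_poly poly_prod)
  then have "cmod (of_rat (coeff m 0)) = (\<Prod>z\<in>S. cmod z)" by (simp add: prod_norm[symmetric])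
  also have "\<dots> = (\<Prod>i\<in>{1..r}. cmod (f i)) * (\<Prod>a\<in>?J. cmod (g a))"
    unfolding S_def using disj inj_f inj_g by (subst prod.union_disjoint) (auto simp: prod.reindex)
  also have "(\<Prod>a\<in>?J. cmod (g a)) = (\<Prod>j\<in>{1..s}. \<Prod>c\<in>UNIV. cmod (g (j, c)))"
    unfolding prod.cartesian_product by simp
  also have "\<dots> = (\<Prod>j\<in>{1..s}. (cmod (\<sigma> j lam))\<^sup>2)"
    by (simp add: g_def UNIV_bool power2_eq_square)
  also have "cmod (of_rat (coeff m 0)) = \<bar>of_rat (coeff m 0)\<bar>"
    by (metis norm_of_real complex_of_real_of_rat)
  finally show ?thesis by (simp add: f_def)
qed

end

end

section \<open>Star map and internal cocycle\<close>

fun coord_sq_modulus :: "(nat \<Rightarrow> real \<Rightarrow> real) \<Rightarrow> (nat \<Rightarrow> real \<Rightarrow> complex) \<Rightarrow> real \<Rightarrow> coord \<Rightarrow> real" where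
  "coord_sq_modulus \<kappa> \<sigma> lam (RealC i) = (\<kappa> i lam)\<^sup>2"
| "coord_sq_modulus \<kappa> \<sigma> lam (ReC j) = (cmod (\<sigma> j lam))\<^sup>2"
| "coord_sq_modulus \<kappa> \<sigma> lam (ImC j) = (cmod (\<sigma> j lam))\<^sup>2"

lemma sum_star_coords:
  "sum h (star_coords r s) = (\<Sum>i\<in>{2..r}. h (RealC i)) + (\<Sum>j\<in>{1..s}. h (ReC j)) + (\<Sum>j\<in>{1..s}. h (ImC j))"
  unfolding star_coords_def
  by (subst sum.union_disjoint, simp, simp, blast)+ (simp add: sum.reindex inj_on_def)

lemma prod_star_coords:
  "prod h (star_coords r s) = (\<Prod>i\<in>{2..r}. h (RealC i)) * (\<Prod>j\<in>{1..s}. h (ReC j)) * (\<Prod>j\<in>{1..s}. h (ImC j))"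
  unfolding star_coords_def
  by (subst prod.union_disjoint, simp, simp, blast)+ (simp add: prod.reindex inj_on_def)

text \<open>The matrix is block diagonal, with blocks of size 1 and scaled rotations of size 2. Rows
  of different blocks have disjoint supports; the two rows of a scaled rotation are orthogonal and
  of equal length.\<close>

lemma star_entry_rows_orthogonal:
  assumes "a \<in> star_coords r s" "b \<in> star_coords r s"
  shows "(\<Sum>x\<in>star_coords r s. star_entry \<kappa> \<sigma> lam a x * star_entry \<kappa> \<sigma> lam b x) =
    (if a = b then coord_sq_modulus \<kappa> \<sigma> lam a else 0)"
proof -
  have delta: "(\<Sum>j\<in>A. (if k = j then x else 0) * (if l = j then y else 0)) = (if k = l then x * y else 0)"
    if "finite A" "k \<in> A" for A and k l :: nat and x y :: real
  proof -
    have "(\<Sum>j\<in>A. (if k = j then x else 0) * (if l = j then y else 0)) =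
        (\<Sum>j\<in>A. if k = j then (if k = l then x * y else 0) else 0)"
      by (intro sum.cong) auto
    then show ?thesis using that by simp
  qed
  have cmod_sq: "(cmod z)\<^sup>2 = Re z * Re z + Im z * Im z" for z
    unfolding cmod_power2 by (simp add: power2_eq_square)
  show ?thesis
    using assms unfolding sum_star_coords
    by (cases a; cases b) (auto simp: star_coords_def delta cmod_sq power2_eq_square[of "\<kappa> _ lam"])
qed

lemma star_matrix_mult_transpose:
  fixes lab :: "'e::finite \<Rightarrow> coord"
  assumes lab: "bij_betw lab UNIV (star_coords r s)"
  shows "(star_matrix \<kappa> \<sigma> lab lam ** transpose (star_matrix \<kappa> \<sigma> lab lam)) $ e $ f =
    (if e = f then coord_sq_modulus \<kappa> \<sigma> lam (lab e) else 0)"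
proof -
  have "(star_matrix \<kappa> \<sigma> lab lam ** transpose (star_matrix \<kappa> \<sigma> lab lam)) $ e $ f =
      (\<Sum>g\<in>UNIV. star_entry \<kappa> \<sigma> lam (lab e) (lab g) * star_entry \<kappa> \<sigma> lam (lab f) (lab g))"
    by (simp add: matrix_matrix_mult_def transpose_def star_matrix_def)
  also have "\<dots> = (\<Sum>x\<in>star_coords r s. star_entry \<kappa> \<sigma> lam (lab e) x * star_entry \<kappa> \<sigma> lam (lab f) x)"
    by (rule sum.reindex_bij_betw[OF lab])
  also have "\<dots> = (if lab e = lab f then coord_sq_modulus \<kappa> \<sigma> lam (lab e) else 0)"
    by (intro star_entry_rows_orthogonal bij_betw_apply[OF lab]) auto
  finally show ?thesis using bij_betw_imp_inj_on[OF lab] by (simp add: inj_eq)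
qed

text \<open>The square of the determinant is the product of the diagonal of
  \<open>Q ** transpose Q\<close>. A non-real embedding occurs there twice, through its real and its
  imaginary coordinate, so its squared modulus survives the square root.\<close>

lemma det_star_matrix:
  fixes lab :: "'e::finite \<Rightarrow> coord"
  assumes lab: "bij_betw lab UNIV (star_coords r s)"
  shows "\<bar>det (star_matrix \<kappa> \<sigma> lab lam)\<bar> =
    (\<Prod>i\<in>{2..r}. \<bar>\<kappa> i lam\<bar>) * (\<Prod>j\<in>{1..s}. (cmod (\<sigma> j lam))\<^sup>2)" (is "\<bar>det ?Q\<bar> = ?x")
proof -
  have "(det ?Q)\<^sup>2 = det (?Q ** transpose ?Q)"
    by (simp add: det_mul det_transpose power2_eq_square)
  also have "\<dots> = (\<Prod>e\<in>UNIV. coord_sq_modulus \<kappa> \<sigma> lam (lab e))"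
    by (subst det_diagonal) (simp_all add: star_matrix_mult_transpose[OF lab])
  also have "\<dots> = prod (coord_sq_modulus \<kappa> \<sigma> lam) (star_coords r s)"
    by (rule prod.reindex_bij_betw[OF lab])
  also have "\<dots> = ?x\<^sup>2"
    by (simp add: prod_star_coords power2_eq_square mult_ac flip: prod.distrib)
  finally have "\<bar>det ?Q\<bar> = \<bar>?x\<bar>" by (simp add: power2_eq_iff abs_eq_iff)
  moreover have "?x \<ge> 0" by (intro mult_nonneg_nonneg prod_nonneg) auto
  ultimately show ?thesis by simp
qed

text \<open>The squared norm of the image is the quadratic form of \<open>Q ** transpose Q\<close>
  at \<open>y\<close>, which is diagonal.\<close>

lemma norm_star_matrix_transpose_mult:
  fixes lab :: "'e::finite \<Rightarrow> coord"
  assumes lab: "bij_betw lab UNIV (star_coords r s)"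
    and q: "\<And>e. coord_sq_modulus \<kappa> \<sigma> lam (lab e) \<le> q\<^sup>2" "q \<ge> 0"
  shows "norm (transpose (star_matrix \<kappa> \<sigma> lab lam) *v y) \<le> q * norm y"
proof (rule power2_le_imp_le)
  let ?Q = "star_matrix \<kappa> \<sigma> lab lam"
  have "(norm (transpose ?Q *v y))\<^sup>2 = (y v* ?Q) \<bullet> (transpose ?Q *v y)"
    by (simp add: power2_norm_eq_inner)
  also have "\<dots> = y \<bullet> ((?Q ** transpose ?Q) *v y)"
    by (simp only: dot_lmul_matrix matrix_vector_mul_assoc)
  also have "\<dots> = (\<Sum>e\<in>UNIV. coord_sq_modulus \<kappa> \<sigma> lam (lab e) * (y $ e)\<^sup>2)"
  proof -
    have "((?Q ** transpose ?Q) *v y) $ e =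
        (\<Sum>f\<in>UNIV. if e = f then coord_sq_modulus \<kappa> \<sigma> lam (lab e) * y $ e else 0)" for e
      unfolding matrix_vector_mult_def
      by (simp only: vec_lambda_beta star_matrix_mult_transpose[OF lab]) (intro sum.cong, auto)
    then show ?thesis by (simp add: inner_vec_def power2_eq_square mult_ac)
  qed
  also have "\<dots> \<le> (\<Sum>e\<in>UNIV. q\<^sup>2 * (y $ e)\<^sup>2)"
    by (intro sum_mono mult_right_mono q) simp
  also have "\<dots> = (q * norm y)\<^sup>2"
    unfolding power_mult_distrib power2_norm_eq_inner inner_vec_def sum_distrib_left
    by (simp add: power2_eq_square)
  finally show "(norm (transpose ?Q *v y))\<^sup>2 \<le> (q * norm y)\<^sup>2" .
qed (simp add: q)

section \<open>Displacement sets and entries of the Fourier matrix\<close>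

lemma displacements_eq_image:
  "displacements \<rho> len i j =
     (\<lambda>k. sum_list (map len (take k (\<rho> j)))) ` {k. k < length (\<rho> j) \<and> \<rho> j ! k = i}"
  by (auto simp: displacements_def)

lemma finite_displacements: "finite (displacements \<rho> len i j)"
  by (simp add: displacements_eq_image)

text \<open>Since tiles have positive length, left endpoints increase strictly, and no two
  occurrences of a letter share a position. Thus the Fourier matrix at 0 is the substitution
  matrix.\<close>

lemma card_displacements:
  assumes "\<And>a. len a > 0"
  shows "card (displacements \<rho> len i j) = count_list (\<rho> j) i"
proof -
  define pos where "pos k = sum_list (map len (take k (\<rho> j)))" for k
  have less: "k < l \<Longrightarrow> l \<le> length (\<rho> j) \<Longrightarrow> pos k < pos l" for k l
  proof (induction l)
    case (Suc l)
    have "pos (Suc l) = pos l + len (\<rho> j ! l)"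
      using Suc.prems by (simp add: pos_def take_Suc_conv_app_nth)
    with Suc assms[of "\<rho> j ! l"] show ?case by (cases "k = l") auto
  qed simp
  have "inj_on pos {k. k < length (\<rho> j) \<and> \<rho> j ! k = i}"
    by (intro linorder_inj_onI') (auto dest: less)
  then have "card (displacements \<rho> len i j) = card {k. k < length (\<rho> j) \<and> \<rho> j ! k = i}"
    unfolding displacements_eq_image pos_def[symmetric] by (rule card_image)
  then show ?thesis
    by (simp add: count_list_eq_length_filter length_filter_conv_card eq_commute)
qed

lemma norm_internal_fourier_le:
  "norm (internal_fourier T star y $ i $ j) \<le> real (card (T i j))"
proof -
  have "norm (exp (2 * of_real pi * \<i> * of_real t)) = 1" for t :: real
    by (metis mult.assoc mult.commute norm_exp_i_times of_real_mult of_real_numeral)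
  then show ?thesis
    unfolding internal_fourier_def using norm_sum[of _ "T i j"] by (simp add: order_trans[OF norm_sum])
qed

text \<open>From |exp(i t) - 1| = 2 |sin(t / 2)| \<le> |t| and the Cauchy-Schwarz inequality: a
  Lipschitz estimate at the origin, where the entry equals \<open>card (T i j)\<close>.\<close>

lemma norm_internal_fourier_diff:
  assumes "finite (T i j)"
  shows "norm (internal_fourier T star y $ i $ j - of_nat (card (T i j)))
    \<le> (\<Sum>x\<in>T i j. 2 * pi * norm (star x)) * norm y"
proof -
  have exp: "norm (exp (2 * of_real pi * \<i> * of_real t) - 1) \<le> 2 * pi * \<bar>t\<bar>" for t :: real
  proof -
    have "exp (2 * of_real pi * \<i> * of_real t) = exp (\<i> * of_real (2 * pi * t))"
      by (simp add: mult_ac)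
    then have "norm (exp (2 * of_real pi * \<i> * of_real t) - 1) = 2 * \<bar>sin (pi * t)\<bar>"
      using dist_exp_i_1[of "2 * pi * t"] by simp
    also have "\<dots> \<le> 2 * \<bar>pi * t\<bar>" using abs_sin_x_le_abs_x by (intro mult_left_mono) auto
    finally show ?thesis by (simp add: abs_mult)
  qed
  have "internal_fourier T star y $ i $ j - of_nat (card (T i j)) =
      (\<Sum>x\<in>T i j. exp (2 * of_real pi * \<i> * of_real (star x \<bullet> y)) - 1)"
    by (simp add: internal_fourier_def sum_subtractf)
  also have "norm \<dots> \<le> (\<Sum>x\<in>T i j. 2 * pi * norm (star x) * norm y)"
  proof (intro sum_norm_le)
    fix x
    have "2 * pi * \<bar>star x \<bullet> y\<bar> \<le> 2 * pi * (norm (star x) * norm y)"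
      by (intro mult_left_mono Cauchy_Schwarz_ineq2) auto
    from order_trans[OF exp this] show "norm (exp (2 * of_real pi * \<i> * of_real (star x \<bullet> y)) - 1)
        \<le> 2 * pi * norm (star x) * norm y" by (simp only: mult.assoc)
  qed
  finally show ?thesis by (simp add: sum_distrib_right)
qed

section \<open>The cocycle as a product of continuous factors\<close>

lemma cocycle_eq_mprod: "cocycle B R n y = mprod (\<lambda>k. B ((((*v) R) ^^ k) y)) n"
  by (induction n) simp_all

lemma continuous_on_cocycle:
  fixes B :: "real ^ 'e::finite \<Rightarrow> complex ^ 'n ^ 'n::finite"
  assumes B: "continuous_on UNIV B"
  shows "continuous_on UNIV (cocycle B R n)"
proof (induction n)
  case 0
  show ?case by simp
next
  case (Suc n)
  have "continuous_on UNIV (((*v) R) ^^ k)" for k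
  proof (induction k)
    case (Suc k)
    have "continuous_on UNIV ((*v) R)" by (intro linear_continuous_on matrix_vector_mul_bounded_linear)
    then show ?case
      using continuous_on_compose[OF Suc] continuous_on_subset by (metis funpow.simps(2) subset_UNIV)
  qed (simp add: id_def)
  then have "continuous_on UNIV (\<lambda>y. B ((((*v) R) ^^ n) y))"
    by (rule continuous_on_compose2[OF B]) simp
  with Suc show ?case
    by (simp add: matrix_matrix_mult_def) (intro continuous_intros)
qed

lemma continuous_on_internal_fourier: "continuous_on UNIV (internal_fourier T star)"
  unfolding internal_fourier_def[abs_def] by (intro continuous_intros)

section \<open>Compact convergence of the scaled cocycle\<close>

theorem theorem4p6:
  fixes \<rho> :: "'n::finite \<Rightarrow> 'n list"
    and M :: "real ^ 'n ^ 'n"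
    and lam \<beta> c :: real
    and d r s :: nat
    and u v :: "real ^ 'n"
    and len :: "'n \<Rightarrow> real"
    and w :: "int \<Rightarrow> 'n"
    and T :: "'n \<Rightarrow> 'n \<Rightarrow> real set"
    and \<kappa> :: "nat \<Rightarrow> real \<Rightarrow> real"
    and \<sigma> :: "nat \<Rightarrow> real \<Rightarrow> complex"
    and lab :: "'e::finite \<Rightarrow> coord"
    and star :: "real \<Rightarrow> real ^ 'e"
    and Q R :: "real ^ 'e ^ 'e"
    and B :: "real ^ 'e \<Rightarrow> complex ^ 'n ^ 'n"
    and C :: "real ^ 'e \<Rightarrow> complex ^ 'n ^ 'n"
  assumes "primitive_subst \<rho>"
    and "M = subst_matrix \<rho>"
    and "PF_eigenvalue M lam"
    and "PV_unit lam d"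
    and "d \<le> CARD('n)"
    and "\<forall>i. v $ i > 0" and "M *v v = lam *\<^sub>R v"
    and "\<forall>i. u $ i > 0" and "u v* M = lam *\<^sub>R u"
    and "(\<Sum>i\<in>UNIV. v $ i) = 1" and "(\<Sum>i\<in>UNIV. u $ i * v $ i) = 1"
    and "c > 0" and "len = (\<lambda>i. c * u $ i)"
    and "w \<in> subst_hull \<rho>" and "adapted_lengths lam len w"
    and "T = displacements \<rho> len"
    and "embedding_system lam r s \<kappa> \<sigma>" and "d = r + 2 * s"
    and "CARD('e) = d - 1" and "bij_betw lab UNIV (star_coords r s)"
    and "star = star_map \<kappa> \<sigma> lab"
    and "Q = star_matrix \<kappa> \<sigma> lab lam"
    and "R = transpose Q"
    and "\<beta> = \<bar>det R\<bar>"
    and "B = internal_fourier T star"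
    and "C = (\<lambda>y. lim (\<lambda>n. \<beta> ^ n *\<^sub>R cocycle B R n y))"
  shows "(\<forall>K. compact K \<longrightarrow>
            uniform_limit K (\<lambda>n y. \<beta> ^ n *\<^sub>R cocycle B R n y) C sequentially)
       \<and> (\<forall>y. (\<lambda>n. \<beta> ^ n *\<^sub>R cocycle B R n y) \<longlonglongrightarrow> C y)
       \<and> continuous_on UNIV C"
proof -
  \<comment> \<open>\<open>A k y\<close> is the scaled factor with index \<open>k\<close>, and
    \<open>N\<close> is its limit once \<beta> = 1 / lam is known. \<open>Nc\<close> and
    \<open>Pc\<close> are complex copies of \<open>N\<close> and of the limit of its powers, because
    the argument for the powers is real.\<close>
  define A where "A k y = \<beta> *\<^sub>R B ((((*v) R) ^^ k) y)" for k y
  define N where "N = (1 / lam) *\<^sub>R M"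
  define Nc where "Nc = (\<chi> i j. complex_of_real (N $ i $ j))"
  define Pc where "Pc = (\<chi> i j. complex_of_real (v $ i * u $ j))"
  obtain m where m: "is_min_poly m lam" and deg: "degree m = d"
    and conj: "\<And>z::complex. poly (map_poly of_rat m) z = 0 \<Longrightarrow> z \<noteq> of_real lam \<Longrightarrow> cmod z < 1"
    and lam: "lam > 1" and alg: "algebraic_int lam" "algebraic_int (inverse lam)"
    using assms(4) unfolding PV_unit_def by blast
  note sys = assms(17) and lab = assms(20)
  have v: "v $ i > 0" and u: "u $ i > 0" for i using assms(6,8) by auto

  \<comment> \<open>Value of the determinant\<close>
  have \<beta>: "\<beta> = 1 / lam"
  proof -
    \<comment> \<open>Internal space omits the identity embedding, so the product over all
      conjugates has the additional factor \<open>lam\<close>.\<close>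
    have "{1..r} = insert 1 {2..r}" using one_in_real_index[OF sys] by auto
    then have "(\<Prod>i\<in>{1..r}. \<bar>\<kappa> i lam\<bar>) = lam * (\<Prod>i\<in>{2..r}. \<bar>\<kappa> i lam\<bar>)"
      using lam kappa_1[OF sys] by simp
    moreover have "\<beta> = (\<Prod>i\<in>{2..r}. \<bar>\<kappa> i lam\<bar>) * (\<Prod>j\<in>{1..s}. (cmod (\<sigma> j lam))\<^sup>2)"
      using assms(22,23,24) by (simp add: det_star_matrix[OF lab])
    ultimately have "lam * \<beta> = \<bar>of_rat (coeff m 0)\<bar>"
      using prod_conjugates[OF sys m] deg assms(18) by (simp add: mult.assoc)
    moreover have "coeff m 0 = 1 \<or> coeff m 0 = -1"
      using min_poly_unit_coeff_0[OF m alg] lam by linarith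
    ultimately have "lam * \<beta> = 1" by auto
    then show ?thesis using lam by (simp add: field_simps)
  qed

  \<comment> \<open>Contraction of internal space\<close>
  obtain q where q: "0 \<le> q" "q < 1" and contract: "\<And>y. norm (R *v y) \<le> q * norm y"
  proof
    let ?D = "\<lambda>e. coord_sq_modulus \<kappa> \<sigma> lam (lab e)"
    \<comment> \<open>This is the largest modulus among the conjugates other than
      \<open>lam\<close>.\<close>
    define q where "q = sqrt (Max (range ?D))"
    have D: "0 \<le> ?D e" "?D e < 1" for e
    proof -
      show "0 \<le> ?D e" by (cases "lab e") auto
      have "lab e \<in> star_coords r s" using bij_betw_apply[OF lab] by blast
      moreover have "cmod (of_real (\<kappa> i lam)) < 1" if "i \<in> {2..r}" for i
        using kappa_ne_gen[OF sys that] that by (intro conj root_complex_of_real[OF sys m]) auto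
      moreover have "cmod (\<sigma> j lam) < 1" if "j \<in> {1..s}" for j
        using nonreal_embedding_at_gen[OF nonreal_embedding[OF sys that]] that
        by (intro conj root_nonreal[OF sys m]) auto
      ultimately show "?D e < 1"
        by (auto simp: star_coords_def abs_square_less_1 power_less_one_iff)
    qed
    have Max: "Max (range ?D) \<ge> 0" "Max (range ?D) < 1"
      using D by (auto simp: Max_ge_iff)
    then show "0 \<le> q" "q < 1" by (simp_all add: q_def)
    have "?D e \<le> q\<^sup>2" for e using Max by (simp add: q_def)
    then show "norm (R *v y) \<le> q * norm y" for y
      using assms(22,23) norm_star_matrix_transpose_mult[OF lab] \<open>0 \<le> q\<close> by blast
  qed
  have contract_pow: "norm ((((*v) R) ^^ k) y) \<le> q ^ k * norm y" for k y
  proof (induction k)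
    case (Suc k)
    from mult_left_mono[OF Suc q(1)] show ?case
      using order_trans[OF contract] by (simp add: mult.assoc)
  qed simp

  \<comment> \<open>The limiting factor and its powers\<close>
  have M_nonneg: "M $ i $ j \<ge> 0" for i j using assms(2) by (simp add: subst_matrix_def)
  have Nv: "N *v v = v" and uN: "u v* N = u"
  proof -
    show "N *v v = v"
      using assms(7) lam by (simp add: N_def flip: scaleR_matrix_vector_assoc)
    have "(u v* N) $ j = (1 / lam) * (u v* M) $ j" for j
      by (simp add: N_def vector_matrix_mult_def sum_distrib_left mult_ac)
    then show "u v* N = u" using assms(9) lam by (simp add: vec_eq_iff)
  qed
  have N_nonneg: "N $ i $ j \<ge> 0" for i j using M_nonneg lam by (simp add: N_def)
  \<comment> \<open>Row bounds see only absolute values, so they pass unchanged between a real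
    matrix and its complex copy.\<close>
  have real_bounded: "row_bounded v (\<chi> i j. complex_of_real (X $ i $ j)) a \<longleftrightarrow> row_bounded v X a" for X a
    by (simp add: row_bounded_def)
  have N1: "row_bounded v Nc 1"
    unfolding Nc_def real_bounded using row_bounded_nonneg[OF N_nonneg, of v 1] Nv by simp

  have Nc_conv: "\<exists>m0. \<forall>m\<ge>m0. row_bounded v (mprod (\<lambda>_. Nc) m - Pc) e" if e: "e > 0" for e
  proof -
    obtain k where "\<And>i j. (((**) M) ^^ k) (mat 1) $ i $ j > 0"
      using assms(1,2) unfolding primitive_subst_def primitive_matrix_def by blast
    \<comment> \<open>Scaling by a positive power of 1 / lam preserves strict positivity of the
      entries.\<close>
    then have "mprod (\<lambda>_. N) k $ i $ j > 0" for i j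
      using lam by (simp add: mprod_const_funpow N_def mprod_scaleR)
    from primitive_powers_converge[OF N_nonneg this v Nv u uN assms(11) e]
    obtain m0 where m0: "\<And>m. m \<ge> m0 \<Longrightarrow> row_bounded v (mprod (\<lambda>_. N) m - (\<chi> i j. v $ i * u $ j)) e"
      by blast
    have eq: "mprod (\<lambda>_. Nc) m - Pc =
        (\<chi> i j. complex_of_real ((mprod (\<lambda>_. N) m - (\<chi> i j. v $ i * u $ j)) $ i $ j))" for m
      by (simp add: Nc_def Pc_def mprod_map_of_real vec_eq_iff)
    show ?thesis unfolding eq real_bounded using m0 by blast
  qed

  \<comment> \<open>Bounds for the scaled factors\<close>
  have card_T: "of_nat (card (T i j)) = M $ i $ j" for i j
    using card_displacements[of len \<rho> i j] assms(2,12,13,16) u by (simp add: subst_matrix_def)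
  have finite_T: "finite (T i j)" for i j
    by (simp add: assms(16) finite_displacements)
  have A1: "row_bounded v (A k y) 1" for k y
    unfolding row_bounded_def
  proof
    fix i
    have "(\<Sum>j\<in>UNIV. norm (A k y $ i $ j) * v $ j) \<le> (\<Sum>j\<in>UNIV. N $ i $ j * v $ j)"
    proof (intro sum_mono mult_right_mono)
      fix j
      have "norm (B z $ i $ j) \<le> M $ i $ j" for z
        using norm_internal_fourier_le[of T star z i j] card_T[of i j] assms(25) by simp
      then show "norm (A k y $ i $ j) \<le> N $ i $ j"
        using lam by (simp add: A_def N_def \<beta> divide_right_mono)
    qed (simp add: v less_imp_le)
    also have "\<dots> = 1 * v $ i"
      using Nv by (simp add: matrix_vector_mult_def vec_eq_iff)
    finally show "(\<Sum>j\<in>UNIV. norm (A k y $ i $ j) * v $ j) \<le> 1 * v $ i" .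
  qed

  \<comment> \<open>Lipschitz constants at 0 of the entries of \<open>B\<close>; the constant
    \<open>c0\<close> obtained from them depends neither on \<open>k\<close> nor on
    \<open>y\<close>.\<close>
  define E where "E i j = (\<Sum>x\<in>T i j. 2 * pi * norm (star x))" for i j
  have E: "E i j \<ge> 0" for i j unfolding E_def by (intro sum_nonneg) auto
  obtain c0 where c0: "c0 \<ge> 0"
    and c0_bound: "\<And>t (X :: complex ^ 'n ^ 'n). t \<ge> 0 \<Longrightarrow> (\<And>i j. norm (X $ i $ j) \<le> E i j * t) \<Longrightarrow>
        row_bounded v X (c0 * t)"
    using row_bounded_entrywise[where 'a = complex and v = v and E = E, OF v E] by auto
  \<comment> \<open>The error is geometric in \<open>k\<close> and depends on \<open>y\<close> only
    through the bound \<open>b\<close>, hence is summable and uniform on bounded sets.\<close>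
  have AN: "row_bounded v (A k y - Nc) (c0 * (\<beta> * (q ^ k * b)))" if b: "norm y \<le> b" for k y b
  proof (rule c0_bound)
    have "b \<ge> 0" using b norm_ge_zero order_trans by blast
    then show "0 \<le> \<beta> * (q ^ k * b)" using q lam by (simp add: \<beta>)
    fix i j
    let ?z = "(((*v) R) ^^ k) y"
    have "norm (B ?z $ i $ j - of_real (M $ i $ j)) \<le> E i j * norm ?z"
      using norm_internal_fourier_diff[of T i j star ?z, OF finite_T]
      by (simp add: E_def assms(25) flip: card_T)
    also have "\<dots> \<le> E i j * (q ^ k * b)"
      using order_trans[OF contract_pow mult_left_mono[OF b, of "q ^ k"]] q E
      by (intro mult_left_mono) auto
    finally have *: "norm (B ?z $ i $ j - of_real (M $ i $ j)) \<le> E i j * (q ^ k * b)" .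
    have "(A k y - Nc) $ i $ j = \<beta> *\<^sub>R (B ?z $ i $ j - of_real (M $ i $ j))"
      by (simp add: A_def Nc_def N_def \<beta> scaleR_conv_of_real[where 'a = complex] right_diff_distrib)
    then have "norm ((A k y - Nc) $ i $ j) = \<beta> * norm (B ?z $ i $ j - of_real (M $ i $ j))"
      using lam by (simp add: \<beta>)
    also have "\<dots> \<le> \<beta> * (E i j * (q ^ k * b))"
      using * lam by (intro mult_left_mono) (auto simp: \<beta>)
    finally show "norm ((A k y - Nc) $ i $ j) \<le> E i j * (\<beta> * (q ^ k * b))"
      by (simp add: mult_ac)
  qed

  \<comment> \<open>Uniform limits and continuity\<close>
  have A_prod: "(\<lambda>n y. mprod (\<lambda>k. A k y) n) = (\<lambda>n y. \<beta> ^ n *\<^sub>R cocycle B R n y)"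
    by (simp add: A_def mprod_scaleR cocycle_eq_mprod fun_eq_iff)
  \<comment> \<open>Boundedness in place of compactness also covers the open balls used for
    continuity.\<close>
  have ul: "uniform_limit K (\<lambda>n y. \<beta> ^ n *\<^sub>R cocycle B R n y) C sequentially" if "bounded K" for K
  proof -
    obtain b where b: "b > 0" "\<And>y. y \<in> K \<Longrightarrow> norm y \<le> b"
      using \<open>bounded K\<close> unfolding bounded_pos by blast
    have "uniformly_convergent_on K (\<lambda>n y. mprod (\<lambda>k. A k y) n)"
    proof (rule uniformly_convergent_mprod[OF v A1 N1])
      show "row_bounded v (A k y - Nc) (c0 * (\<beta> * (q ^ k * b)))" if "y \<in> K" for k y
        using that b(2) AN by blast
      show "0 \<le> c0 * (\<beta> * (q ^ k * b))" for k using c0 b(1) q lam by (simp add: \<beta>)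
      show "summable (\<lambda>k. c0 * (\<beta> * (q ^ k * b)))"
        using q by (intro summable_mult summable_mult2 summable_geometric) simp
    qed (rule Nc_conv)
    \<comment> \<open>A uniformly convergent sequence converges uniformly to its pointwise
      \<open>lim\<close>, which is how \<open>C\<close> is defined.\<close>
    then show ?thesis
      unfolding A_prod uniformly_convergent_uniform_limit_iff assms(26) .
  qed
  have "(\<lambda>n. \<beta> ^ n *\<^sub>R cocycle B R n y) \<longlonglongrightarrow> C y" for y
    by (rule tendsto_uniform_limitI[OF ul[of "{y}"]]) auto
  moreover have "continuous_on UNIV C"
  proof -
    have "continuous_on UNIV (\<lambda>y. \<beta> ^ n *\<^sub>R cocycle B R n y)" for n
      unfolding assms(25)
      by (intro continuous_intros continuous_on_cocycle continuous_on_internal_fourier)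
    \<comment> \<open>Continuity is local: on the unit ball about any point, \<open>C\<close> is a
      uniform limit of continuous functions.\<close>
    then have "continuous_on (ball y 1) C" for y
      by (intro uniform_limit_theorem[OF _ ul] always_eventually) (auto intro: continuous_on_subset)
    then show ?thesis
      by (metis UNIV_I centre_in_ball continuous_on_eq_continuous_at open_UNIV open_ball zero_less_one)
  qed
  ultimately show ?thesis using ul compact_imp_bounded by blast
qed

end
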